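(* If $(\varphi_1,\varphi_2)$ is a classical solution of the system of Hamilton--Jacobi equations $$\frac{\partial\varphi_i}{\partial t}+\mathcal{H}_i(t,x,\nabla\varphi_1,\nabla\varphi_2)=0,\qquad \varphi_i(T,x)=\sigma_i(x),\qquad i=1,2,$$ then it satisfies the following conditions: (F1) $\varphi_i(T,x)=\sigma_i(x)$ for all $x\in\mathbb{R}^n$, $i=1,2$; (F2) for every $(t_*,x_* )\in[0,T]\times\mathbb{R}^n$ and $u\in P$ there exists a motion $y^2(\cdot)\in \mathrm{Sol}^2(t_*,x_*;u)$ such that $\varphi_1(t,y^2(t))\leq\varphi_1(t_*,x_* )$ for all $t\in[t_*,T]$; (F3) for every $(t_*,x_* )\in[0,T]\times\mathbb{R}^n$ and $v\in Q$ there exists a motion $y^1(\cdot)\in \mathrm{Sol}^1(t_*,x_*;v)$ such that $\varphi_2(t,y^1(t))\leq\varphi_2(t_*,x_* )$ for all $t\in[t_*,T]$; (F4) for every $(t_*,x_* )\in[0,T]\times\mathbb{R}^n$ there exists a motion $y^{(c)}(\cdot)\in \mathrm{Sol}(t_*,x_* )$ such that $\varphi_i(t,y^{(c)}(t))=\varphi_i(t_*,x_* )$ for all $t\in[t_*,T]$, $i=1,2$.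
   Context: Consider the controlled system $\dot x=f(t,x,u)+g(t,x,v)$, $t\in[0,T]$, $x\in\mathbb{R}^n$, $u\in P$, $v\in Q$, and functions $\sigma_1,\sigma_2:\mathbb{R}^n\to\mathbb{R}$. The sets $P$ and $Q$ are (nonempty) compact; $f,g,\sigma_1,\sigma_2$ are continuous; $f$ and $g$ are Lipschitz continuous with respect to $x$ and satisfy the sublinear growth condition with respect to $x$. Let $\mathcal{U}$ (resp. $\mathcal{V}$) be the set of measurable functions $[0,T]\to P$ (resp. $[0,T]\to Q$). For $u\in\mathcal{U}$, $v\in\mathcal{V}$, $x(\cdot,t_0,x_0,u,v)$ is the solution of $\dot x(t)=f(t,x(t),u(t))+g(t,x(t),v(t))$, $x(t_0)=x_0$; an element of $P$ or $Q$ in place of $u$ or $v$ means the constant control. With closures taken in the space of continuous vector functions on $[0,T]$: $\mathrm{Sol}^1(t_*,x_*;v_* ):=\mathrm{cl}\{x(\cdot,t_*,x_*,u,v_* ):u\in\mathcal{U}\}$ for $v_*\in Q$; $\mathrm{Sol}^2(t_*,x_*;u_* ):=\mathrm{cl}\{x(\cdot,t_*,x_*,u_*,v):v\in\mathcal{V}\}$ for $u_*\in P$; $\mathrm{Sol}(t_*,x_* ):=\mathrm{cl}\{x(\cdot,t_*,x_*,u,v):u\in\mathcal{U},v\in\mathcal{V}\}$. For $s\in\mathbb{R}^n$ let $\hat u(t,x,s)\in P$ and $\hat v(t,x,s)\in Q$ be (fixed selections) such that $\langle s,f(t,x,\hat u(t,x,s))\rangle=\max_{u\in P}\langle s,f(t,x,u)\rangle$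 and $\langle s,g(t,x,\hat v(t,x,s))\rangle=\max_{v\in Q}\langle s,g(t,x,v)\rangle$. Set $$\mathcal{H}_i(t,x,s_1,s_2):=\langle s_i,f(t,x,\hat u(t,x,s_1))+g(t,x,\hat v(t,x,s_2))\rangle,\quad i=1,2.$$ A classical solution is a continuously differentiable function $(\varphi_1,\varphi_2):[0,T]\times\mathbb{R}^n\to\mathbb{R}^2$ satisfying the equations pointwise together with the terminal conditions; $\nabla$ denotes the gradient in $x$. *)

theory Defs
  imports "HOL-Analysis.Analysis"
begin

text \<open>Standing assumptions on a right-hand side \<open>h\<close> (used for both \<open>f\<close> and \<open>g\<close>).  The constants
  are uniform in time and control; ``sublinear growth'' has the usual control-theoretic meaning
  of growth at most linear in \<open>x\<close>.\<close>

definition regular_rhs ::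
    "real \<Rightarrow> 'c::metric_space set \<Rightarrow> (real \<Rightarrow> real^'n \<Rightarrow> 'c \<Rightarrow> real^'n) \<Rightarrow> bool" where
  "regular_rhs T C h \<longleftrightarrow>
     continuous_on ({0..T} \<times> UNIV \<times> C) (\<lambda>(t, x, c). h t x c) \<and>
     (\<exists>L. \<forall>t\<in>{0..T}. \<forall>c\<in>C. L-lipschitz_on UNIV (\<lambda>x. h t x c)) \<and>
     (\<exists>K. \<forall>t\<in>{0..T}. \<forall>x. \<forall>c\<in>C. norm (h t x c) \<le> K * (1 + norm x))"

definition controls :: "real \<Rightarrow> 'c::metric_space set \<Rightarrow> (real \<Rightarrow> 'c) set" where
  "controls T C = {u. u \<in> borel_measurable (lebesgue_on {0..T}) \<and> (\<forall>t\<in>{0..T}. u t \<in> C)}"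

text \<open>Absolute continuity on \<open>{a..b}\<close>.  The members of a division of \<open>S\<close> are nonempty compact
  intervals \<open>{Inf K..Sup K}\<close> with pairwise disjoint interiors.\<close>

definition abs_continuous_on_ivl ::
    "real \<Rightarrow> real \<Rightarrow> (real \<Rightarrow> 'a::real_normed_vector) \<Rightarrow> bool" where
  "abs_continuous_on_ivl a b x \<longleftrightarrow>
     (\<forall>\<epsilon>>0. \<exists>\<delta>>0. \<forall>D S. D division_of S \<and> S \<subseteq> {a..b} \<and> (\<Sum>K\<in>D. Sup K - Inf K) < \<delta>
        \<longrightarrow> (\<Sum>K\<in>D. norm (x (Sup K) - x (Inf K))) < \<epsilon>)"

text \<open>Caratheodory solutions of the initial value problem on all of \<open>{0..T}\<close>, i.e. both forward
  and backward from \<open>t0\<close>.\<close>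

definition ivp_solution ::
    "real \<Rightarrow> (real \<Rightarrow> real^'n \<Rightarrow> 'p \<Rightarrow> real^'n) \<Rightarrow> (real \<Rightarrow> real^'n \<Rightarrow> 'q \<Rightarrow> real^'n) \<Rightarrow>
     real \<Rightarrow> real^'n \<Rightarrow> (real \<Rightarrow> 'p) \<Rightarrow> (real \<Rightarrow> 'q) \<Rightarrow> (real \<Rightarrow> real^'n) \<Rightarrow> bool" where
  "ivp_solution T f g t0 x0 u v x \<longleftrightarrow>
     abs_continuous_on_ivl 0 T x \<and> x t0 = x0 \<and>
     (AE t in lebesgue_on {0..T}.
        (x has_vector_derivative f t (x t) (u t) + g t (x t) (v t)) (at t within {0..T}))"

text \<open>Elements of the function space \<open>cfunspace\<close> are extensional on \<open>{0..T}\<close>, hence the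
  restriction.  For the right-hand sides considered here the solution is unique for given \<open>u\<close> and
  \<open>v\<close>, so each pair of controls contributes one motion.\<close>

definition motions ::
    "real \<Rightarrow> (real \<Rightarrow> real^'n \<Rightarrow> 'p \<Rightarrow> real^'n) \<Rightarrow> (real \<Rightarrow> real^'n \<Rightarrow> 'q \<Rightarrow> real^'n) \<Rightarrow>
     real \<Rightarrow> real^'n \<Rightarrow> (real \<Rightarrow> 'p) set \<Rightarrow> (real \<Rightarrow> 'q) set \<Rightarrow> (real \<Rightarrow> real^'n) set" where
  "motions T f g t0 x0 U V =
     {restrict x {0..T} | x u v. u \<in> U \<and> v \<in> V \<and> ivp_solution T f g t0 x0 u v x}"

definition cl_C :: "real \<Rightarrow> (real \<Rightarrow> real^'n) set \<Rightarrow> (real \<Rightarrow> real^'n) set" where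
  "cl_C T X = mtopology_of (cfunspace (top_of_set {0..T}) euclidean_metric) closure_of X"

definition Sol1 ::
    "real \<Rightarrow> (real \<Rightarrow> real^'n \<Rightarrow> 'p::metric_space \<Rightarrow> real^'n) \<Rightarrow>
     (real \<Rightarrow> real^'n \<Rightarrow> 'q \<Rightarrow> real^'n) \<Rightarrow> 'p set \<Rightarrow>
     real \<Rightarrow> real^'n \<Rightarrow> 'q \<Rightarrow> (real \<Rightarrow> real^'n) set" where
  "Sol1 T f g P t0 x0 v = cl_C T (motions T f g t0 x0 (controls T P) {\<lambda>_. v})"

definition Sol2 ::
    "real \<Rightarrow> (real \<Rightarrow> real^'n \<Rightarrow> 'p \<Rightarrow> real^'n) \<Rightarrow>
     (real \<Rightarrow> real^'n \<Rightarrow> 'q::metric_space \<Rightarrow> real^'n) \<Rightarrow> 'q set \<Rightarrow>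
     real \<Rightarrow> real^'n \<Rightarrow> 'p \<Rightarrow> (real \<Rightarrow> real^'n) set" where
  "Sol2 T f g Q t0 x0 u = cl_C T (motions T f g t0 x0 {\<lambda>_. u} (controls T Q))"

definition Sol ::
    "real \<Rightarrow> (real \<Rightarrow> real^'n \<Rightarrow> 'p::metric_space \<Rightarrow> real^'n) \<Rightarrow>
     (real \<Rightarrow> real^'n \<Rightarrow> 'q::metric_space \<Rightarrow> real^'n) \<Rightarrow> 'p set \<Rightarrow> 'q set \<Rightarrow>
     real \<Rightarrow> real^'n \<Rightarrow> (real \<Rightarrow> real^'n) set" where
  "Sol T f g P Q t0 x0 = cl_C T (motions T f g t0 x0 (controls T P) (controls T Q))"

definition max_selection ::
    "real \<Rightarrow> 'c set \<Rightarrow> (real \<Rightarrow> real^'n \<Rightarrow> 'c \<Rightarrow> real^'n) \<Rightarrow>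
     (real \<Rightarrow> real^'n \<Rightarrow> real^'n \<Rightarrow> 'c) \<Rightarrow> bool" where
  "max_selection T C h c \<longleftrightarrow>
     (\<forall>t\<in>{0..T}. \<forall>x s. is_arg_max (\<lambda>w. s \<bullet> h t x w) (\<lambda>w. w \<in> C) (c t x s))"

definition Ham1 ::
    "(real \<Rightarrow> real^'n \<Rightarrow> 'p \<Rightarrow> real^'n) \<Rightarrow> (real \<Rightarrow> real^'n \<Rightarrow> 'q \<Rightarrow> real^'n) \<Rightarrow>
     (real \<Rightarrow> real^'n \<Rightarrow> real^'n \<Rightarrow> 'p) \<Rightarrow> (real \<Rightarrow> real^'n \<Rightarrow> real^'n \<Rightarrow> 'q) \<Rightarrow>
     real \<Rightarrow> real^'n \<Rightarrow> real^'n \<Rightarrow> real^'n \<Rightarrow> real" where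
  "Ham1 f g uh vh t x s1 s2 = s1 \<bullet> (f t x (uh t x s1) + g t x (vh t x s2))"

definition Ham2 ::
    "(real \<Rightarrow> real^'n \<Rightarrow> 'p \<Rightarrow> real^'n) \<Rightarrow> (real \<Rightarrow> real^'n \<Rightarrow> 'q \<Rightarrow> real^'n) \<Rightarrow>
     (real \<Rightarrow> real^'n \<Rightarrow> real^'n \<Rightarrow> 'p) \<Rightarrow> (real \<Rightarrow> real^'n \<Rightarrow> real^'n \<Rightarrow> 'q) \<Rightarrow>
     real \<Rightarrow> real^'n \<Rightarrow> real^'n \<Rightarrow> real^'n \<Rightarrow> real" where
  "Ham2 f g uh vh t x s1 s2 = s2 \<bullet> (f t x (uh t x s1) + g t x (vh t x s2))"

text \<open>Derivatives are taken within the closed strip: at \<open>t = 0\<close> and \<open>t = T\<close> the time derivative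
  is one-sided.\<close>

definition C1_strip :: "real \<Rightarrow> (real \<Rightarrow> real^'n \<Rightarrow> real) \<Rightarrow> bool" where
  "C1_strip T \<phi> \<longleftrightarrow>
     (\<exists>\<phi>' :: real \<times> (real^'n) \<Rightarrow> (real \<times> (real^'n)) \<Rightarrow>\<^sub>L real.
        continuous_on ({0..T} \<times> UNIV) \<phi>' \<and>
        (\<forall>z\<in>{0..T} \<times> UNIV.
           ((\<lambda>(t, x). \<phi> t x) has_derivative blinfun_apply (\<phi>' z)) (at z within {0..T} \<times> UNIV)))"

definition time_deriv :: "real \<Rightarrow> (real \<Rightarrow> real^'n \<Rightarrow> real) \<Rightarrow> real \<Rightarrow> real^'n \<Rightarrow> real" where
  "time_deriv T \<phi> t x = vector_derivative (\<lambda>\<tau>. \<phi> \<tau> x) (at t within {0..T})"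

definition grad :: "(real^'n \<Rightarrow> real) \<Rightarrow> real^'n \<Rightarrow> real^'n" where
  "grad h x = (THE s. GDERIV h x :> s)"

definition classical_solution ::
    "real \<Rightarrow> (real \<Rightarrow> real^'n \<Rightarrow> 'p \<Rightarrow> real^'n) \<Rightarrow> (real \<Rightarrow> real^'n \<Rightarrow> 'q \<Rightarrow> real^'n) \<Rightarrow>
     (real \<Rightarrow> real^'n \<Rightarrow> real^'n \<Rightarrow> 'p) \<Rightarrow> (real \<Rightarrow> real^'n \<Rightarrow> real^'n \<Rightarrow> 'q) \<Rightarrow>
     (real^'n \<Rightarrow> real) \<Rightarrow> (real^'n \<Rightarrow> real) \<Rightarrow>
     (real \<Rightarrow> real^'n \<Rightarrow> real) \<Rightarrow> (real \<Rightarrow> real^'n \<Rightarrow> real) \<Rightarrow> bool" where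
  "classical_solution T f g uh vh \<sigma>1 \<sigma>2 \<phi>1 \<phi>2 \<longleftrightarrow>
     C1_strip T \<phi>1 \<and> C1_strip T \<phi>2 \<and>
     (\<forall>t\<in>{0..T}. \<forall>x.
        time_deriv T \<phi>1 t x + Ham1 f g uh vh t x (grad (\<phi>1 t) x) (grad (\<phi>2 t) x) = 0 \<and>
        time_deriv T \<phi>2 t x + Ham2 f g uh vh t x (grad (\<phi>1 t) x) (grad (\<phi>2 t) x) = 0) \<and>
     (\<forall>x. \<phi>1 T x = \<sigma>1 x \<and> \<phi>2 T x = \<sigma>2 x)"

end

theory Submission
  imports Defs "HOL-Complex_Analysis.Great_Picard"
begin

text \<open>
  Let \<open>\<phi>\<close> be one of the two components and let the players use the extremal feedbacks
  \<open>u\<^sup>*(t, x) = uh t x (grad (\<phi>1 t) x)\<close> and \<open>v\<^sup>*(t, x) = vh t x (grad (\<phi>2 t) x)\<close>.  Along a motion driven by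
  both of them the Hamilton--Jacobi equations say that \<open>\<phi>1\<close> and \<open>\<phi>2\<close> have derivative zero.  If the
  first player holds a constant \<open>u\<close> instead, only the term \<open>grad \<phi>1 \<bullet> f\<close> of the derivative of \<open>\<phi>1\<close>
  changes, and it can only drop, because \<open>u\<^sup>*\<close> maximizes it; so \<open>\<phi>1\<close> decreases.  The same holds for
  \<open>\<phi>2\<close> against a constant \<open>v\<close>.

  The feedbacks are discontinuous, so the closed-loop equation may have no solution.  They are
  therefore applied with sampling: the control is frozen on each interval of a fine partition at
  the feedback value of its left end.  At the sampling points the derivative of \<open>\<phi>\<close> has the right
  sign, and in between it changes by at most \<open>\<epsilon>\<close>, because the data are uniformly continuous on a
  compact tube containing all motions (\<open>dissipative_increment\<close>).  Hence \<open>\<phi>\<close> grows by at most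
  \<open>\<epsilon> * (t - s)\<close> along the sampled motion (\<open>euler_feedback_motion_exists\<close>).  These motions are
  uniformly bounded and Lipschitz, so by Arzela--Ascoli some of them converge uniformly as
  \<open>\<epsilon>\<close> tends to zero; the limit belongs to the closure that defines \<open>Sol\<close>, \<open>Sol1\<close> or \<open>Sol2\<close>, and
  along it \<open>\<phi>\<close> does not exceed its initial value (\<open>dissipative_limit_motion\<close>).

  All three existence claims are instances of one result, \<open>feedback_limit_in_closure\<close>, for a single
  controller with values in \<open>{u} \<times> Q\<close>, \<open>P \<times> {v}\<close> or \<open>P \<times> Q\<close>.  It treats finitely many functions at
  once; equality in the third case comes from using it for \<open>\<phi>1\<close>, \<open>\<phi>2\<close> and their negatives.
\<close>

section \<open>Increments of functions differentiable off a finite set\<close>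

text \<open>Sampled controls jump, so motions are differentiable only off a finite set.  The strong form
  of the fundamental theorem of calculus tolerates that.\<close>

lemma increment_le_of_derivative_le:
  fixes F :: "real \<Rightarrow> real"
  assumes "a \<le> b" "continuous_on {a..b} F" "finite S"
    and der: "\<And>t. t \<in> {a<..<b} - S \<Longrightarrow> (F has_real_derivative F' t) (at t)"
    and le: "\<And>t. t \<in> {a<..<b} - S \<Longrightarrow> F' t \<le> B"
  shows "F b - F a \<le> B * (b - a)"
proof -
  define k where "k = (\<lambda>t. if t \<in> {a<..<b} - S then F' t else B)"
  have "(k has_integral (F b - F a)) {a..b}"
  proof (rule fundamental_theorem_of_calculus_interior_strong[OF \<open>finite S\<close> \<open>a \<le> b\<close> _ assms(2)])
    fix t assume "t \<in> {a<..<b} - S"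
    then show "(F has_vector_derivative k t) (at t)"
      using der[of t] by (simp add: k_def has_real_derivative_iff_has_vector_derivative)
  qed
  moreover have "((\<lambda>_. B) has_integral B * (b - a)) {a..b}"
    using has_integral_const_real[of B a b] \<open>a \<le> b\<close> by (simp add: mult.commute)
  ultimately show ?thesis
    by (rule has_integral_le) (auto simp: k_def le)
qed

text \<open>The scalar case in the direction of \<open>x b - x a\<close>.\<close>

lemma norm_increment_le_of_derivative_le:
  fixes x :: "real \<Rightarrow> 'a::real_inner"
  assumes "a \<le> b" "continuous_on {a..b} x" "finite S"
    and der: "\<And>t. t \<in> {a<..<b} - S \<Longrightarrow> (x has_vector_derivative x' t) (at t)"
    and le: "\<And>t. t \<in> {a<..<b} - S \<Longrightarrow> norm (x' t) \<le> B"
  shows "norm (x b - x a) \<le> B * (b - a)"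
proof -
  define e where "e = sgn (x b - x a)"
  have "norm e \<le> 1"
    by (simp add: e_def norm_sgn)
  have "x b \<bullet> e - x a \<bullet> e \<le> B * (b - a)"
  proof (rule increment_le_of_derivative_le[OF assms(1) _ assms(3)])
    show "continuous_on {a..b} (\<lambda>t. x t \<bullet> e)"
      by (intro continuous_intros assms)
    fix t assume t: "t \<in> {a<..<b} - S"
    show "((\<lambda>t. x t \<bullet> e) has_real_derivative x' t \<bullet> e) (at t)"
      using bounded_linear.has_vector_derivative[OF bounded_linear_inner_left der[OF t], of e]
      by (simp add: has_real_derivative_iff_has_vector_derivative)
    have "x' t \<bullet> e \<le> norm (x' t) * norm e"
      by (rule norm_cauchy_schwarz)
    also have "\<dots> \<le> norm (x' t) * 1"
      using \<open>norm e \<le> 1\<close> by (intro mult_left_mono) auto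
    finally show "x' t \<bullet> e \<le> B" using le[OF t] by simp
  qed
  moreover have "v \<bullet> sgn v = norm v" for v :: 'a
    by (cases "v = 0") (simp_all add: sgn_div_norm dot_square_norm power2_eq_square)
  then have "x b \<bullet> e - x a \<bullet> e = norm (x b - x a)"
    unfolding e_def inner_diff_left[symmetric] by simp
  ultimately show ?thesis by simp
qed

section \<open>Existence of motions\<close>

text \<open>Banach's fixed point theorem for the Picard operator.  The base point \<open>s\<close> may lie anywhere in
  the interval, so that one contraction argument covers solutions forward and backward in time.\<close>

lemma picard_short_interval:
  fixes h :: "real \<Rightarrow> 'a::euclidean_space \<Rightarrow> 'a"
  assumes "a \<le> b" and s: "s \<in> {a..b}"
    and cont: "continuous_on ({a..b} \<times> UNIV) (\<lambda>(t, x). h t x)"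
    and lip: "\<And>t. t \<in> {a..b} \<Longrightarrow> L-lipschitz_on UNIV (h t)"
    and short: "L * (b - a) \<le> 1 / 2"
  obtains x where "continuous_on {a..b} x" "x s = \<xi>"
    "\<And>t. t \<in> {a<..<b} \<Longrightarrow> (x has_vector_derivative h t (x t)) (at t)"
proof -
  have "0 \<le> L"
    using lip[OF s] by (rule lipschitz_on_nonneg)
  define J where "J = (\<lambda>(y :: real \<Rightarrow>\<^sub>C 'a) t. \<xi> + integral {a..t} (\<lambda>r. h r (y r))
    - integral {a..s} (\<lambda>r. h r (y r)))"
  have cont_h: "continuous_on {a..b} (\<lambda>r. h r (y r))" for y :: "real \<Rightarrow>\<^sub>C 'a"
  proof -
    have "continuous_on {a..b} (\<lambda>r. (\<lambda>(t, x). h t x) (r, y r))"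
      by (rule continuous_on_compose2[OF cont]) (auto intro!: continuous_intros)
    then show ?thesis by simp
  qed
  have J_deriv: "(J y has_vector_derivative h t (y t)) (at t within {a..b})"
    if "t \<in> {a..b}" for y t
    unfolding J_def
    using integral_has_vector_derivative[OF cont_h that, of y]
    by (auto intro!: derivative_eq_intros)
  have J_cont: "continuous_on {a..b} (J y)" for y
    using J_deriv by (meson continuous_on_eq_continuous_within has_vector_derivative_continuous)
  \<comment> \<open>The contraction acts on the complete space of bounded continuous functions on the whole line;
    clamping the argument makes \<open>J y\<close> an element of it.\<close>
  have "\<exists>z :: real \<Rightarrow>\<^sub>C 'a. \<forall>t. z t = J y (clamp a b t)" for y
    using continuous_on_cbox_bcontfunE[of a b "J y"] J_cont[of y] by (metis box_real(2))
  then obtain \<Theta> where \<Theta>: "\<And>y t. apply_bcontfun (\<Theta> y) t = J y (clamp a b t)"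
    by metis
  have contr: "dist (\<Theta> y) (\<Theta> z) \<le> 1 / 2 * dist y z" for y z
  proof (rule dist_bound)
    fix t
    define u where "u = clamp a b t"
    have u: "u \<in> {a..b}"
      using clamp_in_interval[of a b t] \<open>a \<le> b\<close> by (simp add: u_def)
    define D where "D = (\<lambda>t. J y t - J z t)"
    have D_le: "norm (D q - D p) \<le> L * dist y z * (q - p)"
      if "p \<in> {a..b}" "q \<in> {a..b}" "p \<le> q" for p q
    proof (rule norm_increment_le_of_derivative_le[OF \<open>p \<le> q\<close>, of _ "{}"])
      show "continuous_on {p..q} D"
        unfolding D_def using that
        by (intro continuous_intros continuous_on_subset[OF J_cont]) auto
      fix r assume r: "r \<in> {p<..<q} - {}"
      then have "at r within {a..b} = at r"
        using that by (intro at_within_Icc_at) auto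
      then show "(D has_vector_derivative h r (y r) - h r (z r)) (at r)"
        unfolding D_def using J_deriv[of r y] J_deriv[of r z] r that
        by (auto intro!: derivative_intros)
      have "norm (h r (y r) - h r (z r)) \<le> L * dist (y r) (z r)"
        using lipschitz_onD[OF lip[of r], of "y r" "z r"] r that by (simp add: dist_norm)
      also have "\<dots> \<le> L * dist y z"
        using \<open>0 \<le> L\<close> by (intro mult_left_mono dist_bounded)
      finally show "norm (h r (y r) - h r (z r)) \<le> L * dist y z" .
    qed simp
    have "D s = 0" by (simp add: D_def J_def)
    have "norm (D u) \<le> L * dist y z * \<bar>u - s\<bar>"
      using D_le[of s u] D_le[of u s] u s \<open>D s = 0\<close> by (cases "s \<le> u") auto
    also have "\<dots> \<le> L * dist y z * (b - a)"
      using u s \<open>0 \<le> L\<close> by (intro mult_left_mono) auto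
    also have "\<dots> \<le> 1 / 2 * dist y z"
      using mult_right_mono[OF short, of "dist y z"] by (simp add: mult_ac)
    finally show "dist (\<Theta> y t) (\<Theta> z t) \<le> 1 / 2 * dist y z"
      by (simp add: \<Theta> D_def u_def dist_norm)
  qed
  obtain y where y: "\<Theta> y = y"
    using banach_fix_type[of "1/2" \<Theta>] contr by auto
  have y_eq: "y t = J y t" if "t \<in> {a..b}" for t
    using \<Theta>[of y t] that by (simp add: y)
  show ?thesis
  proof
    show "continuous_on {a..b} (apply_bcontfun y)" by simp
    show "y s = \<xi>"
      using y_eq[OF s] by (simp add: J_def)
    fix t assume t: "t \<in> {a<..<b}"
    then have "(J y has_vector_derivative h t (y t)) (at t)"
      using J_deriv[of t y] at_within_Icc_at[of a t b] by auto
    then show "(apply_bcontfun y has_vector_derivative h t (y t)) (at t)"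
      by (rule has_vector_derivative_transform_within_open[of _ _ _ "{a<..<b}"])
         (use t y_eq in auto)
  qed
qed

text \<open>Derivatives are required only at interior points, off a finite set.  This makes concatenation
  trivial and turns every curve on a one-point interval into a motion.\<close>

definition motion_on ::
    "(real \<Rightarrow> 'a::real_normed_vector \<Rightarrow> 'c \<Rightarrow> 'a) \<Rightarrow> real \<Rightarrow> real \<Rightarrow> (real \<Rightarrow> 'c) \<Rightarrow>
     (real \<Rightarrow> 'a) \<Rightarrow> bool" where
  "motion_on h a b w x \<longleftrightarrow> continuous_on {a..b} x \<and>
     (\<exists>S. finite S \<and>
        (\<forall>t\<in>{a<..<b} - S. (x has_vector_derivative h t (x t) (w t)) (at t)))"

lemma motion_on_glue:
  assumes xy: "motion_on h a m v x" "motion_on h m b w y" and eq: "x m = y m"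
    and "a \<le> m" "m \<le> b"
  shows "motion_on h a b (\<lambda>t. if t \<le> m then v t else w t) (\<lambda>t. if t \<le> m then x t else y t)"
proof -
  let ?z = "\<lambda>t. if t \<le> m then x t else y t" and ?u = "\<lambda>t. if t \<le> m then v t else w t"
  obtain S R where S: "finite S" "\<And>t. t \<in> {a<..<m} - S \<Longrightarrow> (x has_vector_derivative h t (x t) (v t)) (at t)"
    and R: "finite R" "\<And>t. t \<in> {m<..<b} - R \<Longrightarrow> (y has_vector_derivative h t (y t) (w t)) (at t)"
    using xy unfolding motion_on_def by metis
  have "continuous_on ({a..m} \<union> {m..b}) ?z"
    using xy eq by (intro continuous_on_cases) (auto simp: motion_on_def)
  moreover have "{a..m} \<union> {m..b} = {a..b}"
    using assms(4,5) by auto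
  moreover have "(?z has_vector_derivative h t (?z t) (?u t)) (at t)"
    if t: "t \<in> {a<..<b} - (S \<union> R \<union> {m})" for t
  proof (cases "t < m")
    case True
    then show ?thesis
      using t has_vector_derivative_transform_within_open[OF S(2)[of t], of "{..<m}" ?z] by auto
  next
    case False
    then show ?thesis
      using t has_vector_derivative_transform_within_open[OF R(2)[of t], of "{m<..}" ?z] by auto
  qed
  ultimately show ?thesis
    unfolding motion_on_def using S(1) R(1)
    by (metis (no_types, lifting) finite.emptyI finite_UnI finite_insert)
qed

locale control_system =
  fixes T L K :: real and C :: "'c::metric_space set"
    and h :: "real \<Rightarrow> 'a::euclidean_space \<Rightarrow> 'c \<Rightarrow> 'a"
  assumes compact_C: "compact C"
    and cont_h: "continuous_on ({0..T} \<times> UNIV \<times> C) (\<lambda>(t, x, c). h t x c)"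
    and lipschitz_h: "\<lbrakk>t \<in> {0..T}; c \<in> C\<rbrakk> \<Longrightarrow> L-lipschitz_on UNIV (\<lambda>x. h t x c)"
    and growth_h: "\<lbrakk>t \<in> {0..T}; c \<in> C\<rbrakk> \<Longrightarrow> norm (h t x c) \<le> K * (1 + norm x)"
    and K_nonneg: "0 \<le> K"
begin

text \<open>The Picard argument needs a short interval.  A long one is bisected: solve first on the half
  that contains the base point, then on the other half from the value reached at the midpoint.\<close>

lemma constant_control_motion_exists:
  assumes ab: "0 \<le> a" "a \<le> b" "b \<le> T" and s: "s \<in> {a..b}" and c: "c \<in> C"
  obtains x where "motion_on h a b (\<lambda>_. c) x" "x s = \<xi>"
proof -
  have halving: "\<exists>x. motion_on h a b (\<lambda>_. c) x \<and> x s = \<xi>"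
    if "0 \<le> a" "a \<le> b" "b \<le> T" "s \<in> {a..b}" "L * (b - a) \<le> 2 ^ n / 2" for n a b s \<xi>
    using that
  proof (induction n arbitrary: a b s \<xi>)
    case 0
    have "continuous_on ({a..b} \<times> UNIV) (\<lambda>z. (\<lambda>(t, x, c). h t x c) (fst z, snd z, c))"
      using 0 c by (intro continuous_on_compose2[OF cont_h]) (auto intro!: continuous_intros)
    then have *: "continuous_on ({a..b} \<times> UNIV) (\<lambda>(t, x). h t x c)"
      by (simp add: case_prod_unfold)
    have lip: "L-lipschitz_on UNIV (\<lambda>x. h t x c)" if "t \<in> {a..b}" for t
      using that 0 c by (intro lipschitz_h) auto
    have short: "L * (b - a) \<le> 1 / 2"
      using 0 by simp
    obtain x where "continuous_on {a..b} x" "x s = \<xi>"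
      "\<And>t. t \<in> {a<..<b} \<Longrightarrow> (x has_vector_derivative h t (x t) c) (at t)"
      using picard_short_interval[OF 0(2,4) * lip short, of \<xi>] by blast
    then show ?case
      unfolding motion_on_def by (intro exI[of _ x]) auto
  next
    case (Suc n)
    define m where "m = (a + b) / 2"
    have m: "a \<le> m" "m \<le> b" "L * (m - a) \<le> 2 ^ n / 2" "L * (b - m) \<le> 2 ^ n / 2"
      using Suc.prems by (auto simp: m_def field_simps)
    show ?case
    proof (cases "s \<le> m")
      case True
      obtain x where x: "motion_on h a m (\<lambda>_. c) x" "x s = \<xi>"
        using Suc.IH[of a m s \<xi>] Suc.prems m True by auto
      obtain y where y: "motion_on h m b (\<lambda>_. c) y" "y m = x m"
        using Suc.IH[of m b m "x m"] Suc.prems m by auto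
      show ?thesis
        using motion_on_glue[OF x(1) y(1)] x y m True
        by (intro exI[of _ "\<lambda>t. if t \<le> m then x t else y t"]) auto
    next
      case False
      obtain y where y: "motion_on h m b (\<lambda>_. c) y" "y s = \<xi>"
        using Suc.IH[of m b s \<xi>] Suc.prems m False by auto
      obtain x where x: "motion_on h a m (\<lambda>_. c) x" "x m = y m"
        using Suc.IH[of a m m "y m"] Suc.prems m by auto
      show ?thesis
        using motion_on_glue[OF x(1) y(1)] x y m False
        by (intro exI[of _ "\<lambda>t. if t \<le> m then x t else y t"]) auto
    qed
  qed
  obtain n where "2 * (L * (b - a)) < 2 ^ n"
    using real_arch_pow[of 2] by auto
  then show ?thesis
    using halving[of a b s n \<xi>] ab s that by fastforce
qed

text \<open>Gronwall's argument in both time directions.  Growth at most linear gives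
  \<open>\<bar>d/dt (1 + \<bar>x\<bar>\<^sup>2)\<bar> \<le> 3 * K * (1 + \<bar>x\<bar>\<^sup>2)\<close>, so \<open>exp (\<mp> 3 * K * t) * (1 + \<bar>x\<bar>\<^sup>2)\<close> is monotone.  The bound does
  not depend on the control, which is what compactness requires.\<close>

lemma motion_bound:
  assumes ab: "0 \<le> a" "b \<le> T" and x: "motion_on h a b w x" and w: "range w \<subseteq> C"
    and st: "s \<in> {a..b}" "t \<in> {a..b}"
  shows "norm (x t) \<le> (1 + (norm (x s))\<^sup>2) * exp (3 * K * T)"
proof -
  obtain S where S: "finite S"
    "\<And>t. t \<in> {a<..<b} - S \<Longrightarrow> (x has_vector_derivative h t (x t) (w t)) (at t)"
    using x unfolding motion_on_def by metis
  have x_cont: "continuous_on {a..b} x"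
    using x by (simp add: motion_on_def)
  have rate: "\<bar>2 * (x t \<bullet> h t (x t) (w t))\<bar> \<le> 3 * K * (1 + x t \<bullet> x t)" if "t \<in> {a..b}" for t
  proof -
    let ?r = "norm (x t)"
    have "\<bar>x t \<bullet> h t (x t) (w t)\<bar> \<le> ?r * norm (h t (x t) (w t))"
      by (rule Cauchy_Schwarz_ineq2)
    also have "\<dots> \<le> ?r * (K * (1 + ?r))"
      using that ab w by (intro mult_left_mono growth_h) auto
    also have "\<dots> = K * (?r + ?r\<^sup>2)"
      by (simp add: power2_eq_square algebra_simps)
    also have "\<dots> \<le> K * ((3 + 3 * ?r\<^sup>2) / 2)"
      using K_nonneg zero_le_power2[of "?r - 1"]
      by (intro mult_left_mono) (auto simp: power2_diff)
    finally show ?thesis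
      by (simp add: power2_norm_eq_inner algebra_simps)
  qed
  \<comment> \<open>The sign \<open>\<sigma>\<close> handles both directions at once: the weight \<open>exp (- 3 * K * t)\<close> makes the function
    decrease (bound after \<open>s\<close>), the weight \<open>exp (3 * K * t)\<close> makes it increase (bound before \<open>s\<close>).\<close>
  have weighted: "exp (\<kappa> * q) * (1 + x q \<bullet> x q) * \<sigma> - exp (\<kappa> * p) * (1 + x p \<bullet> x p) * \<sigma> \<le> 0 * (q - p)"
    if pq: "p \<in> {a..b}" "q \<in> {a..b}" "p \<le> q" and \<sigma>: "\<sigma> = 1 \<and> \<kappa> = - 3 * K \<or> \<sigma> = - 1 \<and> \<kappa> = 3 * K"
    for p q \<kappa> \<sigma>
  proof (rule increment_le_of_derivative_le[OF \<open>p \<le> q\<close> _ S(1)])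
    show "continuous_on {p..q} (\<lambda>t. exp (\<kappa> * t) * (1 + x t \<bullet> x t) * \<sigma>)"
      using pq by (intro continuous_intros continuous_on_subset[OF x_cont]) auto
    fix t assume t: "t \<in> {p<..<q} - S"
    then have t': "t \<in> {a<..<b} - S" using pq by auto
    have "((\<lambda>t. x t \<bullet> x t) has_real_derivative 2 * (x t \<bullet> h t (x t) (w t))) (at t)"
      using S(2)[OF t'] unfolding has_vector_derivative_def has_field_derivative_def
      by (auto intro!: derivative_eq_intros simp: inner_commute algebra_simps)
    then show "((\<lambda>t. exp (\<kappa> * t) * (1 + x t \<bullet> x t) * \<sigma>) has_real_derivative
        exp (\<kappa> * t) * (\<sigma> * (\<kappa> * (1 + x t \<bullet> x t) + 2 * (x t \<bullet> h t (x t) (w t))))) (at t)"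
      by (auto intro!: derivative_eq_intros simp: algebra_simps)
    have "\<sigma> * (\<kappa> * (1 + x t \<bullet> x t) + 2 * (x t \<bullet> h t (x t) (w t))) \<le> 0"
      using rate[of t] t' \<sigma> by (auto simp: algebra_simps)
    then show "exp (\<kappa> * t) * (\<sigma> * (\<kappa> * (1 + x t \<bullet> x t) + 2 * (x t \<bullet> h t (x t) (w t)))) \<le> 0"
      by (simp add: mult_le_0_iff)
  qed
  have "1 + x t \<bullet> x t \<le> (1 + x s \<bullet> x s) * exp (3 * K * \<bar>t - s\<bar>)"
  proof (cases "s \<le> t")
    case True
    then show ?thesis
      using weighted[of s t 1 "- 3 * K"] st
      by (simp add: exp_minus exp_diff field_simps)
  next
    case False
    then show ?thesis
      using weighted[of t s "- 1" "3 * K"] st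
      by (simp add: exp_minus exp_diff field_simps)
  qed
  also have "\<dots> \<le> (1 + x s \<bullet> x s) * exp (3 * K * T)"
    using st ab K_nonneg by (intro mult_left_mono) (auto intro!: mult_left_mono)
  finally have "1 + (norm (x t))\<^sup>2 \<le> (1 + (norm (x s))\<^sup>2) * exp (3 * K * T)"
    by (simp add: power2_norm_eq_inner)
  moreover have "2 * norm (x t) \<le> 1 + (norm (x t))\<^sup>2"
    using zero_le_power2[of "norm (x t) - 1"] by (simp add: power2_diff)
  ultimately show ?thesis using zero_le_power2[of "norm (x t)"] norm_ge_zero[of "x t"]
    by linarith
qed

lemma motion_lipschitz:
  assumes ab: "0 \<le> a" "b \<le> T" and x: "motion_on h a b w x" and w: "range w \<subseteq> C"
    and bound: "\<And>t. t \<in> {a..b} \<Longrightarrow> norm (x t) \<le> R" and "0 \<le> R"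
  shows "(K * (1 + R))-lipschitz_on {a..b} x"
proof (rule lipschitz_onI)
  show "0 \<le> K * (1 + R)" using K_nonneg \<open>0 \<le> R\<close> by simp
  obtain S where S: "finite S"
    "\<And>t. t \<in> {a<..<b} - S \<Longrightarrow> (x has_vector_derivative h t (x t) (w t)) (at t)"
    using x unfolding motion_on_def by metis
  have le: "norm (x q - x p) \<le> K * (1 + R) * (q - p)"
    if pq: "p \<in> {a..b}" "q \<in> {a..b}" "p \<le> q" for p q
  proof (rule norm_increment_le_of_derivative_le[OF \<open>p \<le> q\<close> _ S(1)])
    show "continuous_on {p..q} x"
      using x pq by (auto simp: motion_on_def intro: continuous_on_subset)
    fix t assume t: "t \<in> {p<..<q} - S"
    then show "(x has_vector_derivative h t (x t) (w t)) (at t)"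
      using pq by (intro S(2)) auto
    have "norm (h t (x t) (w t)) \<le> K * (1 + norm (x t))"
      using t pq ab w by (intro growth_h) auto
    also have "\<dots> \<le> K * (1 + R)"
      using t pq bound K_nonneg by (intro mult_left_mono) auto
    finally show "norm (h t (x t) (w t)) \<le> K * (1 + R)" .
  qed
  fix p q assume "p \<in> {a..b}" "q \<in> {a..b}"
  then show "dist (x p) (x q) \<le> K * (1 + R) * dist p q"
    using le[of p q] le[of q p]
    by (cases "p \<le> q") (auto simp: dist_norm norm_minus_commute)
qed

end

section \<open>Sampled feedback\<close>

text \<open>The closed loop \<open>k\<close> nowhere increases the \<open>C\<^sup>1\<close> function \<open>\<phi>\<close>.  This is a condition on the vector
  field rather than on its trajectories, because these need not exist for a discontinuous \<open>k\<close>.\<close>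

definition dissipative ::
    "real \<Rightarrow> (real \<Rightarrow> 'a::euclidean_space \<Rightarrow> 'c \<Rightarrow> 'a) \<Rightarrow> (real \<Rightarrow> 'a \<Rightarrow> 'c) \<Rightarrow>
     (real \<Rightarrow> 'a \<Rightarrow> real) \<Rightarrow> bool" where
  "dissipative T h k \<phi> \<longleftrightarrow>
     (\<exists>\<phi>' :: real \<times> 'a \<Rightarrow> (real \<times> 'a) \<Rightarrow>\<^sub>L real.
        continuous_on ({0..T} \<times> UNIV) \<phi>' \<and>
        (\<forall>z\<in>{0..T} \<times> UNIV.
           ((\<lambda>(t, x). \<phi> t x) has_derivative blinfun_apply (\<phi>' z)) (at z within {0..T} \<times> UNIV)) \<and>
        (\<forall>t\<in>{0..T}. \<forall>x. \<phi>' (t, x) (1, h t x (k t x)) \<le> 0))"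

lemma dissipative_continuous:
  assumes "dissipative T h k \<phi>"
  shows "continuous_on ({0..T} \<times> UNIV) (\<lambda>(t, x). \<phi> t x)"
  using assms unfolding dissipative_def
  by (metis (no_types, lifting) continuous_on_eq_continuous_within has_derivative_continuous)

context control_system
begin

text \<open>Freezing the control at \<open>c = k a (x a)\<close> costs at most \<open>\<epsilon>\<close> in the rate of \<open>\<phi>\<close>.  The rate
  \<open>G (t, x, c)\<close> is nonpositive at \<open>(a, x a, c)\<close>, and uniformly continuous on the compact set
  \<open>{0..T} \<times> cball 0 R \<times> C\<close>.  Discontinuity of \<open>k\<close> is harmless, as \<open>c\<close> is the same at both points
  compared.  The admissible step size is the same for all motions in the tube.\<close>

lemma dissipative_increment:
  assumes \<phi>: "dissipative T h k \<phi>" and "0 < \<epsilon>" and "0 \<le> R"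
  obtains \<delta> where "0 < \<delta>"
    "\<And>a b c x. \<lbrakk>0 \<le> a; a \<le> b; b \<le> T; b - a < \<delta>; c = k a (x a); c \<in> C;
        motion_on h a b (\<lambda>_. c) x; \<And>t. t \<in> {a..b} \<Longrightarrow> norm (x t) \<le> R\<rbrakk>
      \<Longrightarrow> \<forall>t\<in>{a..b}. \<phi> t (x t) \<le> \<phi> a (x a) + \<epsilon> * (t - a)"
proof -
  obtain \<phi>' :: "real \<times> 'a \<Rightarrow> (real \<times> 'a) \<Rightarrow>\<^sub>L real" where
    \<phi>'_cont: "continuous_on ({0..T} \<times> UNIV) \<phi>'" and
    \<phi>'_deriv: "\<And>z. z \<in> {0..T} \<times> UNIV \<Longrightarrow>
      ((\<lambda>(t, x). \<phi> t x) has_derivative blinfun_apply (\<phi>' z)) (at z within {0..T} \<times> UNIV)" and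
    \<phi>'_le: "\<And>t x. t \<in> {0..T} \<Longrightarrow> \<phi>' (t, x) (1, h t x (k t x)) \<le> 0"
    using \<phi> unfolding dissipative_def by metis
  define G where "G = (\<lambda>(t, x, c). \<phi>' (t, x) (1, h t x c))"
  let ?D = "{0..T} \<times> cball (0 :: 'a) R \<times> C"
  have "continuous_on ?D (\<lambda>z. \<phi>' (fst z, fst (snd z)))"
    by (rule continuous_on_compose2[OF \<phi>'_cont]) (auto intro!: continuous_intros)
  moreover have "continuous_on ?D (\<lambda>z. h (fst z) (fst (snd z)) (snd (snd z)))"
    using continuous_on_subset[OF cont_h, of ?D] by (auto simp: case_prod_unfold)
  ultimately have "continuous_on ?D G"
    unfolding G_def case_prod_unfold
    by (intro continuous_intros)
  moreover have "compact ?D"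
    by (intro compact_Times compact_C compact_cball compact_Icc)
  ultimately have G_unif: "uniformly_continuous_on ?D G"
    by (rule compact_uniformly_continuous)
  obtain \<eta> where \<eta>: "0 < \<eta>"
    "\<And>z z'. \<lbrakk>z \<in> ?D; z' \<in> ?D; dist z' z < \<eta>\<rbrakk> \<Longrightarrow> dist (G z') (G z) < \<epsilon>"
    using uniformly_continuous_onE[OF G_unif \<open>0 < \<epsilon>\<close>] by blast
  define M where "M = K * (1 + R)"
  have "0 \<le> M" using K_nonneg \<open>0 \<le> R\<close> by (simp add: M_def)
  show thesis
  proof
    show "0 < \<eta> / (1 + M)" using \<eta>(1) \<open>0 \<le> M\<close> by simp
    fix a b c x
    assume ab: "0 \<le> a" "a \<le> b" "b \<le> T" and short: "b - a < \<eta> / (1 + M)"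
      and c: "c = k a (x a)" "c \<in> C" and x: "motion_on h a b (\<lambda>_. c) x"
      and R: "\<And>t. t \<in> {a..b} \<Longrightarrow> norm (x t) \<le> R"
    have lip: "M-lipschitz_on {a..b} x"
      unfolding M_def
      by (rule motion_lipschitz[OF ab(1,3) x]) (use c R \<open>0 \<le> R\<close> in auto)
    obtain S where S: "finite S"
      "\<And>t. t \<in> {a<..<b} - S \<Longrightarrow> (x has_vector_derivative h t (x t) c) (at t)"
      using x unfolding motion_on_def by metis
    have G_le: "G (t, x t, c) \<le> \<epsilon>" if t: "t \<in> {a..b}" for t
    proof -
      have "dist (t, x t, c) (a, x a, c) \<le> dist t a + dist (x t) (x a)"
        unfolding dist_Pair_Pair using sqrt_sum_squares_le_sum[of "dist t a" "dist (x t) (x a)"] by simp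
      also have "\<dots> \<le> (1 + M) * (t - a)"
        using lipschitz_onD[OF lip, of t a] t ab by (simp add: dist_real_def algebra_simps)
      also have "\<dots> \<le> (1 + M) * (b - a)"
        using t \<open>0 \<le> M\<close> by (intro mult_left_mono) auto
      also have "\<dots> < \<eta>"
        using short \<open>0 \<le> M\<close> by (simp add: pos_less_divide_eq mult.commute)
      finally have "dist (G (t, x t, c)) (G (a, x a, c)) < \<epsilon>"
        using t ab c R by (intro \<eta>(2)) auto
      moreover have "G (a, x a, c) \<le> 0"
        using \<phi>'_le[of a "x a"] ab by (simp add: G_def c)
      ultimately show ?thesis by (simp add: dist_real_def)
    qed
    have curve_cont: "continuous_on {a..b} (\<lambda>t. \<phi> t (x t))"
    proof -
      have "continuous_on {a..b} (\<lambda>t. (\<lambda>(t, x). \<phi> t x) (t, x t))"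
        using x ab
        by (intro continuous_on_compose2[OF dissipative_continuous[OF \<phi>]])
           (auto simp: motion_on_def intro!: continuous_intros)
      then show ?thesis by simp
    qed
    have "\<phi> t (x t) - \<phi> a (x a) \<le> \<epsilon> * (t - a)" if t: "t \<in> {a..b}" for t
    proof (rule increment_le_of_derivative_le[OF _ _ S(1)])
      show "a \<le> t" using t by simp
      show "continuous_on {a..t} (\<lambda>t. \<phi> t (x t))"
        using curve_cont by (rule continuous_on_subset) (use t in auto)
      fix r assume r: "r \<in> {a<..<t} - S"
      then have r': "r \<in> {a<..<b} - S" "r \<in> {0<..<T}" using t ab by auto
      have at_r: "at r within {0..T} = at r"
        using r' by (intro at_within_Icc_at) auto
      have "((\<lambda>t. (t, x t)) has_derivative (\<lambda>d. (d, d *\<^sub>R h r (x r) c))) (at r within {0..T})"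
        using S(2)[OF r'(1)] unfolding at_r has_vector_derivative_def
        by (intro has_derivative_Pair has_derivative_ident)
      then have "((\<lambda>t. (\<lambda>(t, x). \<phi> t x) (t, x t)) has_derivative
          (\<lambda>d. \<phi>' (r, x r) (d, d *\<^sub>R h r (x r) c))) (at r within {0..T})"
        using r' by (intro has_derivative_in_compose2[OF \<phi>'_deriv]) auto
      moreover have "\<phi>' (r, x r) (d, d *\<^sub>R h r (x r) c) = G (r, x r, c) * d" for d
        using blinfun.scaleR_right[of "\<phi>' (r, x r)" d "(1, h r (x r) c)"]
        by (simp add: G_def)
      ultimately show "((\<lambda>t. \<phi> t (x t)) has_real_derivative G (r, x r, c)) (at r)"
        unfolding at_r has_field_derivative_def by simp
      show "G (r, x r, c) \<le> \<epsilon>"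
        using r t by (intro G_le) auto
    qed
    then show "\<forall>t\<in>{a..b}. \<phi> t (x t) \<le> \<phi> a (x a) + \<epsilon> * (t - a)"
      by (simp add: algebra_simps)
  qed
qed

text \<open>Induction over the sampling points of \<open>{s..T}\<close>.  As motions must live on all of \<open>{0..T}\<close>, the
  result is continued backward from \<open>s\<close> with an arbitrary constant control.\<close>

lemma euler_feedback_motion_exists:
  assumes "finite \<Phi>" and \<Phi>: "\<And>\<phi>. \<phi> \<in> \<Phi> \<Longrightarrow> dissipative T h k \<phi>"
    and k: "\<And>t x. t \<in> {0..T} \<Longrightarrow> k t x \<in> C"
    and s: "s \<in> {0..T}" and "0 < \<epsilon>"
  obtains w x where "motion_on h 0 T w x" "x s = \<xi>" "range w \<subseteq> C" "w \<in> borel_measurable borel"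
    "\<And>\<phi> t. \<lbrakk>\<phi> \<in> \<Phi>; t \<in> {s..T}\<rbrakk> \<Longrightarrow> \<phi> t (x t) \<le> \<phi> s \<xi> + \<epsilon> * (t - s)"
proof -
  define R where "R = (1 + (norm \<xi>)\<^sup>2) * exp (3 * K * T)"
  have "0 \<le> R" by (simp add: R_def)
  define step_ok where "step_ok = (\<lambda>\<phi> \<delta>. \<forall>a b c x. 0 \<le> a \<longrightarrow> a \<le> b \<longrightarrow> b \<le> T \<longrightarrow> b - a < \<delta> \<longrightarrow>
      c = k a (x a) \<longrightarrow> c \<in> C \<longrightarrow> motion_on h a b (\<lambda>_. c) x \<longrightarrow>
      (\<forall>t\<in>{a..b}. norm (x t) \<le> R) \<longrightarrow> (\<forall>t\<in>{a..b}. \<phi> t (x t) \<le> \<phi> a (x a) + \<epsilon> * (t - a)))"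
  have "\<exists>\<delta>>0. step_ok \<phi> \<delta>" if \<phi>: "\<phi> \<in> \<Phi>" for \<phi>
  proof -
    obtain \<delta> where "0 < \<delta>" "\<And>a b c x. \<lbrakk>0 \<le> a; a \<le> b; b \<le> T; b - a < \<delta>; c = k a (x a); c \<in> C;
        motion_on h a b (\<lambda>_. c) x; \<And>t. t \<in> {a..b} \<Longrightarrow> norm (x t) \<le> R\<rbrakk>
      \<Longrightarrow> \<forall>t\<in>{a..b}. \<phi> t (x t) \<le> \<phi> a (x a) + \<epsilon> * (t - a)"
      using dissipative_increment[OF \<Phi>[OF \<phi>] \<open>0 < \<epsilon>\<close> \<open>0 \<le> R\<close>] by blast
    then show ?thesis unfolding step_ok_def by (intro exI[of _ \<delta>] conjI) blast+
  qed
  then obtain d where d: "\<And>\<phi>. \<phi> \<in> \<Phi> \<Longrightarrow> 0 < d \<phi> \<and> step_ok \<phi> (d \<phi>)"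
    by metis
  define \<delta> where "\<delta> = Min (insert 1 (d ` \<Phi>))"
  have "0 < \<delta>"
    using \<open>finite \<Phi>\<close> d by (auto simp: \<delta>_def)
  have \<delta>_le: "\<delta> \<le> d \<phi>" if "\<phi> \<in> \<Phi>" for \<phi>
    using \<open>finite \<Phi>\<close> that by (auto simp: \<delta>_def)
  obtain N :: nat where N: "(T - s) / \<delta> < real N"
    using reals_Archimedean2 by blast
  have "0 < real N"
    using N s \<open>0 < \<delta>\<close> by (smt (verit) atLeastAtMost_iff divide_nonneg_nonneg)
  define \<tau> where "\<tau> = (T - s) / real N"
  have \<tau>: "0 \<le> \<tau>" "\<tau> < \<delta>" "s + real N * \<tau> = T"
    using N s \<open>0 < real N\<close> \<open>0 < \<delta>\<close> by (auto simp: \<tau>_def field_simps)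
  have "\<exists>w x. motion_on h s (s + real n * \<tau>) w x \<and> x s = \<xi> \<and> range w \<subseteq> C \<and>
      w \<in> borel_measurable borel \<and>
      (\<forall>\<phi>\<in>\<Phi>. \<forall>t\<in>{s..s + real n * \<tau>}. \<phi> t (x t) \<le> \<phi> s \<xi> + \<epsilon> * (t - s))" if "n \<le> N" for n
    using that
  proof (induction n)
    case 0
    have "motion_on h s s (\<lambda>_. k s \<xi>) (\<lambda>_. \<xi>)"
      by (auto simp: motion_on_def intro: exI[of _ "{}"])
    then show ?case
      using k[OF s, of \<xi>] by (intro exI[of _ "\<lambda>_. k s \<xi>"] exI[of _ "\<lambda>_. \<xi>"]) auto
  next
    case (Suc n)
    define m where "m = s + real n * \<tau>"
    define b where "b = s + real (Suc n) * \<tau>"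
    have "real (Suc n) * \<tau> \<le> real N * \<tau>"
      using Suc.prems \<tau>(1) by (intro mult_right_mono) auto
    then have mb: "0 \<le> m" "s \<le> m" "m \<le> b" "b \<le> T" "b - m < \<delta>"
      using s \<tau> unfolding m_def b_def by (auto simp: algebra_simps)
    obtain v x where x: "motion_on h s m v x" "x s = \<xi>" "range v \<subseteq> C" "v \<in> borel_measurable borel"
      "\<And>\<phi> t. \<lbrakk>\<phi> \<in> \<Phi>; t \<in> {s..m}\<rbrakk> \<Longrightarrow> \<phi> t (x t) \<le> \<phi> s \<xi> + \<epsilon> * (t - s)"
      using Suc.IH Suc.prems unfolding m_def by (metis Suc_leD)
    define c where "c = k m (x m)"
    have "c \<in> C" using k[of m "x m"] mb by (simp add: c_def)
    obtain y where y: "motion_on h m b (\<lambda>_. c) y" "y m = x m"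
      using constant_control_motion_exists[of m b m c "x m"] mb \<open>c \<in> C\<close> by auto
    define z where "z = (\<lambda>t. if t \<le> m then x t else y t)"
    define w where "w = (\<lambda>t. if t \<le> m then v t else c)"
    have z: "motion_on h s b w z"
      unfolding z_def w_def using motion_on_glue[OF x(1) y(1)] y(2) mb by simp
    have w: "range w \<subseteq> C" "w \<in> borel_measurable borel"
      using x(3,4) \<open>c \<in> C\<close> by (auto simp: w_def intro!: measurable_If)
    have z_s: "z s = \<xi>" using x(2) mb by (simp add: z_def)
    have z_bound: "norm (z t) \<le> R" if "t \<in> {s..b}" for t
      using motion_bound[OF _ _ z w(1), of s t] that s mb z_s by (auto simp: R_def)
    have y_z: "y t = z t" if "t \<in> {m..b}" for t
      using that y(2) by (auto simp: z_def)
    have "\<phi> t (z t) \<le> \<phi> s \<xi> + \<epsilon> * (t - s)" if "\<phi> \<in> \<Phi>" and t: "t \<in> {s..b}" for \<phi> t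
    proof (cases "t \<le> m")
      case True
      then show ?thesis using x(5)[OF \<open>\<phi> \<in> \<Phi>\<close>, of t] t by (simp add: z_def)
    next
      case False
      have "\<forall>t\<in>{m..b}. norm (y t) \<le> R"
        using z_bound y_z mb by auto
      moreover have "b - m < d \<phi>"
        using mb \<delta>_le[OF \<open>\<phi> \<in> \<Phi>\<close>] by simp
      moreover have "step_ok \<phi> (d \<phi>)" using d[OF \<open>\<phi> \<in> \<Phi>\<close>] by simp
      ultimately have "\<forall>t\<in>{m..b}. \<phi> t (y t) \<le> \<phi> m (y m) + \<epsilon> * (t - m)"
        unfolding step_ok_def using mb y \<open>c \<in> C\<close> by (metis c_def)
      then have "\<phi> t (y t) \<le> \<phi> m (x m) + \<epsilon> * (t - m)"
        using t False y(2) by auto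
      also have "\<dots> \<le> \<phi> s \<xi> + \<epsilon> * (m - s) + \<epsilon> * (t - m)"
        using x(5)[OF \<open>\<phi> \<in> \<Phi>\<close>, of m] mb by simp
      finally show ?thesis
        using False by (simp add: z_def algebra_simps)
    qed
    then show ?case
      using z z_s w unfolding b_def[symmetric] by blast
  qed
  from this[of N] obtain w x where x: "motion_on h s T w x" "x s = \<xi>" "range w \<subseteq> C"
    "w \<in> borel_measurable borel"
    "\<And>\<phi> t. \<lbrakk>\<phi> \<in> \<Phi>; t \<in> {s..T}\<rbrakk> \<Longrightarrow> \<phi> t (x t) \<le> \<phi> s \<xi> + \<epsilon> * (t - s)"
    unfolding \<tau>(3) by blast
  define c where "c = k s \<xi>"
  have "c \<in> C" using k[OF s] by (simp add: c_def)
  obtain y where y: "motion_on h 0 s (\<lambda>_. c) y" "y s = \<xi>"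
    using constant_control_motion_exists[of 0 s s c \<xi>] s \<open>c \<in> C\<close> by auto
  show thesis
  proof
    show "motion_on h 0 T (\<lambda>t. if t \<le> s then c else w t) (\<lambda>t. if t \<le> s then y t else x t)"
      using motion_on_glue[OF y(1) x(1)] x(2) y(2) s by simp
    show "(\<lambda>t. if t \<le> s then c else w t) \<in> borel_measurable borel"
      using x(4) by (auto intro!: measurable_If)
    fix \<phi> t assume "\<phi> \<in> \<Phi>" "t \<in> {s..T}"
    then show "\<phi> t (if t \<le> s then y t else x t) \<le> \<phi> s \<xi> + \<epsilon> * (t - s)"
      using x(5)[of \<phi> t] x(2) y(2) by (cases "t = s") auto
  qed (use x(3) y(2) \<open>c \<in> C\<close> in auto)
qed

text \<open>Sampled motions for \<open>\<epsilon> = 1 / (n + 1)\<close> are bounded and Lipschitz with constants independent of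
  \<open>n\<close>, so Arzela--Ascoli applies.\<close>

lemma dissipative_limit_motion:
  assumes "finite \<Phi>" and \<Phi>: "\<And>\<phi>. \<phi> \<in> \<Phi> \<Longrightarrow> dissipative T h k \<phi>"
    and k: "\<And>t x. t \<in> {0..T} \<Longrightarrow> k t x \<in> C"
    and s: "s \<in> {0..T}"
  obtains y where "continuous_on {0..T} y"
    "\<And>\<epsilon>. 0 < \<epsilon> \<Longrightarrow> \<exists>w x. motion_on h 0 T w x \<and> x s = \<xi> \<and> range w \<subseteq> C \<and> w \<in> borel_measurable borel \<and>
       (\<forall>t\<in>{0..T}. dist (y t) (x t) < \<epsilon>)"
    "\<And>\<phi> t. \<lbrakk>\<phi> \<in> \<Phi>; t \<in> {s..T}\<rbrakk> \<Longrightarrow> \<phi> t (y t) \<le> \<phi> s \<xi>"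
proof -
  define e where "e = (\<lambda>n. inverse (real (Suc n)))"
  have "\<exists>w x. motion_on h 0 T w x \<and> x s = \<xi> \<and> range w \<subseteq> C \<and> w \<in> borel_measurable borel \<and>
      (\<forall>\<phi>\<in>\<Phi>. \<forall>t\<in>{s..T}. \<phi> t (x t) \<le> \<phi> s \<xi> + e n * (t - s))" for n
    using euler_feedback_motion_exists[OF \<open>finite \<Phi>\<close> \<Phi> k s, of "e n" \<xi>]
    by (metis e_def inverse_positive_iff_positive of_nat_0_less_iff zero_less_Suc)
  then obtain w x where x: "\<And>n. motion_on h 0 T (w n) (x n)" "\<And>n. x n s = \<xi>"
    "\<And>n. range (w n) \<subseteq> C" "\<And>n. w n \<in> borel_measurable borel"
    "\<And>n \<phi> t. \<lbrakk>\<phi> \<in> \<Phi>; t \<in> {s..T}\<rbrakk> \<Longrightarrow> \<phi> t (x n t) \<le> \<phi> s \<xi> + e n * (t - s)"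
    by metis
  define R where "R = (1 + (norm \<xi>)\<^sup>2) * exp (3 * K * T)"
  have bound: "norm (x n t) \<le> R" if "t \<in> {0..T}" for n t
    using motion_bound[OF _ _ x(1,3) s that] x(2) by (simp add: R_def)
  have "0 \<le> R" by (simp add: R_def)
  have lip: "(K * (1 + R))-lipschitz_on {0..T} (x n)" for n
    using motion_lipschitz[OF _ _ x(1,3) bound \<open>0 \<le> R\<close>] by simp
  have "\<exists>d>0. \<forall>n r. r \<in> {0..T} \<and> norm (t - r) < d \<longrightarrow> norm (x n t - x n r) < \<eta>"
    if t: "t \<in> {0..T}" and "0 < \<eta>" for t \<eta>
  proof -
    \<comment> \<open>The summand 1 keeps the divisor below positive when \<open>K = 0\<close>.\<close>
    define M where "M = K * (1 + R) + 1"
    have "0 < M" using K_nonneg \<open>0 \<le> R\<close> by (simp add: M_def add_nonneg_pos)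
    have "norm (x n t - x n r) < \<eta>" if "r \<in> {0..T}" "norm (t - r) < \<eta> / M" for n r
    proof -
      have "norm (x n t - x n r) \<le> K * (1 + R) * norm (t - r)"
        using lipschitz_onD[OF lip t that(1), of n] by (simp add: dist_norm)
      also have "\<dots> \<le> M * norm (t - r)"
        by (intro mult_right_mono) (auto simp: M_def)
      also have "\<dots> < \<eta>"
        using that(2) \<open>0 < M\<close> by (simp add: pos_less_divide_eq mult.commute)
      finally show ?thesis .
    qed
    then show ?thesis using \<open>0 < \<eta>\<close> \<open>0 < M\<close> by (intro exI[of _ "\<eta> / M"]) auto
  qed
  then obtain y \<rho> where y: "continuous_on {0..T} y" "strict_mono (\<rho> :: nat \<Rightarrow> nat)"
    "\<And>\<epsilon>. 0 < \<epsilon> \<Longrightarrow> \<exists>N. \<forall>n t. n \<ge> N \<and> t \<in> {0..T} \<longrightarrow> norm (x (\<rho> n) t - y t) < \<epsilon>"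
    using Arzela_Ascoli[of "{0..T}" x R] bound by blast
  show thesis
  proof
    show "continuous_on {0..T} y" by fact
    show "\<exists>w x. motion_on h 0 T w x \<and> x s = \<xi> \<and> range w \<subseteq> C \<and> w \<in> borel_measurable borel \<and>
       (\<forall>t\<in>{0..T}. dist (y t) (x t) < \<epsilon>)" if \<epsilon>: "0 < \<epsilon>" for \<epsilon>
    proof -
      obtain N where "\<forall>n t. n \<ge> N \<and> t \<in> {0..T} \<longrightarrow> norm (x (\<rho> n) t - y t) < \<epsilon>"
        using y(3)[OF \<epsilon>] by blast
      then have "\<forall>t\<in>{0..T}. dist (y t) (x (\<rho> N) t) < \<epsilon>"
        by (auto simp: dist_norm norm_minus_commute)
      then show ?thesis using x(1-4) by blast
    qed
    fix \<phi> t assume \<phi>: "\<phi> \<in> \<Phi>" and t: "t \<in> {s..T}"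
    then have t0: "t \<in> {0..T}" using s by auto
    have "(\<lambda>n. x (\<rho> n) t) \<longlonglongrightarrow> y t"
      unfolding LIMSEQ_def dist_norm using y(3) t0 by meson
    moreover have "continuous_on UNIV (\<phi> t)"
    proof -
      have "continuous_on UNIV (\<lambda>x. (\<lambda>(t, x). \<phi> t x) (t, x))"
        using t0 by (intro continuous_on_compose2[OF dissipative_continuous[OF \<Phi>[OF \<phi>]]])
                    (auto intro!: continuous_intros)
      then show ?thesis by simp
    qed
    ultimately have lhs: "(\<lambda>n. \<phi> t (x (\<rho> n) t)) \<longlonglongrightarrow> \<phi> t (y t)"
      by (auto intro: continuous_on_tendsto_compose)
    have "e \<longlonglongrightarrow> 0"
      unfolding e_def by (rule LIMSEQ_inverse_real_of_nat)
    then have "(\<lambda>n. e (\<rho> n)) \<longlonglongrightarrow> 0"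
      using LIMSEQ_subseq_LIMSEQ[OF _ y(2)] by (auto simp: o_def)
    then have rhs: "(\<lambda>n. \<phi> s \<xi> + e (\<rho> n) * (t - s)) \<longlonglongrightarrow> \<phi> s \<xi> + 0 * (t - s)"
      by (intro tendsto_intros)
    show "\<phi> t (y t) \<le> \<phi> s \<xi>"
      using LIMSEQ_le[OF lhs rhs] x(5)[OF \<phi> t] by auto
  qed
qed

end

section \<open>Motions of the two-player system and their closure\<close>

lemma lipschitz_imp_abs_continuous_on_ivl:
  assumes "M-lipschitz_on {a..b} x"
  shows "abs_continuous_on_ivl a b x"
  unfolding abs_continuous_on_ivl_def
proof (intro allI impI)
  fix \<epsilon> :: real assume "0 < \<epsilon>"
  have "0 \<le> M" using assms by (rule lipschitz_on_nonneg)
  show "\<exists>\<delta>>0. \<forall>D S. D division_of S \<and> S \<subseteq> {a..b} \<and> (\<Sum>K\<in>D. Sup K - Inf K) < \<delta>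
        \<longrightarrow> (\<Sum>K\<in>D. norm (x (Sup K) - x (Inf K))) < \<epsilon>"
  proof (intro exI[of _ "\<epsilon> / (M + 1)"] conjI allI impI)
    show "0 < \<epsilon> / (M + 1)" using \<open>0 < \<epsilon>\<close> \<open>0 \<le> M\<close> by simp
    fix D S assume D: "D division_of S \<and> S \<subseteq> {a..b} \<and> (\<Sum>K\<in>D. Sup K - Inf K) < \<epsilon> / (M + 1)"
    have K: "norm (x (Sup K) - x (Inf K)) \<le> (M + 1) * (Sup K - Inf K)" if KD: "K \<in> D" for K
    proof -
      obtain p q where K_eq: "K = {p..q}"
        using division_ofD(4)[OF conjunct1[OF D] KD] by auto
      moreover have "K \<noteq> {}" "K \<subseteq> {a..b}"
        using division_ofD(2,3)[OF conjunct1[OF D] KD] D by auto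
      ultimately have "p \<le> q" "p \<in> {a..b}" "q \<in> {a..b}" by auto
      then have "norm (x q - x p) \<le> M * (q - p)"
        using lipschitz_onD[OF assms, of q p] by (simp add: dist_norm)
      also have "\<dots> \<le> (M + 1) * (q - p)"
        using \<open>p \<le> q\<close> by (intro mult_right_mono) auto
      finally show ?thesis using \<open>p \<le> q\<close> by (simp add: K_eq)
    qed
    have "(\<Sum>K\<in>D. norm (x (Sup K) - x (Inf K))) \<le> (M + 1) * (\<Sum>K\<in>D. Sup K - Inf K)"
      unfolding sum_distrib_left by (intro sum_mono K)
    also have "\<dots> < \<epsilon>"
      using D \<open>0 \<le> M\<close> by (simp add: pos_less_divide_eq mult.commute)
    finally show "(\<Sum>K\<in>D. norm (x (Sup K) - x (Inf K))) < \<epsilon>" .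
  qed
qed

text \<open>The closure is taken in the metric of uniform convergence, where members are restricted to
  \<open>{0..T}\<close>; this criterion hides the restrictions.\<close>

lemma cl_C_memI:
  assumes "continuous_on {0..T} y"
    and "\<And>\<epsilon>. 0 < \<epsilon> \<Longrightarrow> \<exists>x. continuous_on {0..T} x \<and> restrict x {0..T} \<in> X \<and>
           (\<forall>t\<in>{0..T}. dist (y t) (x t) < \<epsilon>)"
  shows "restrict y {0..T} \<in> cl_C T X"
proof -
  let ?F = "cfunspace (top_of_set {0..T}) (euclidean_metric :: (real^'n) metric)"
  have F: "restrict x {0..T} \<in> mspace ?F" if "continuous_on {0..T} x" for x :: "real \<Rightarrow> real^'n"
  proof -
    have "continuous_on {0..T} (restrict x {0..T})"
      using that by (simp cong: continuous_on_cong_simp)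
    then show ?thesis
      by (subst compactin_mspace_cfunspace) (auto simp: compactin_subtopology)
  qed
  interpret F: Metric_space "mspace ?F" "mdist ?F"
    by (rule Metric_space_mspace_mdist)
  have "\<exists>z\<in>X. z \<in> F.mcball (restrict y {0..T}) r" if "0 < r" for r
  proof -
    obtain x where x: "continuous_on {0..T} x" "restrict x {0..T} \<in> X"
      "\<forall>t\<in>{0..T}. dist (y t) (x t) < r"
      using assms(2)[OF \<open>0 < r\<close>] by blast
    have "mdist ?F (restrict y {0..T}) (restrict x {0..T}) \<le> r"
      using x(3) \<open>0 < r\<close> by (intro mdist_cfunspace_le) (auto simp: less_imp_le)
    then show ?thesis
      using F[OF assms(1)] F[OF x(1)] x(2) unfolding F.mcball_def by blast
  qed
  then show ?thesis
    unfolding cl_C_def mtopology_of_def F.metric_closure_of_alt using F[OF assms(1)] by blast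
qed

text \<open>The two players act as one controller with values in the product of their control sets.
  Subsets are allowed so that a player can be confined to a single control.\<close>

lemma control_system_of_regular_rhs:
  fixes f :: "real \<Rightarrow> real^'n \<Rightarrow> 'p::metric_space \<Rightarrow> real^'n"
    and g :: "real \<Rightarrow> real^'n \<Rightarrow> 'q::metric_space \<Rightarrow> real^'n"
  assumes f: "regular_rhs T P f" and g: "regular_rhs T Q g"
    and P': "compact P'" "P' \<subseteq> P" and Q': "compact Q'" "Q' \<subseteq> Q"
  obtains L K where "control_system T L K (P' \<times> Q') (\<lambda>t x c. f t x (fst c) + g t x (snd c))"
proof -
  obtain L1 K1 where f_cont: "continuous_on ({0..T} \<times> UNIV \<times> P) (\<lambda>(t, x, c). f t x c)"
    and f_lip: "\<And>t c. \<lbrakk>t \<in> {0..T}; c \<in> P\<rbrakk> \<Longrightarrow> L1-lipschitz_on UNIV (\<lambda>x. f t x c)"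
    and f_growth: "\<And>t x c. \<lbrakk>t \<in> {0..T}; c \<in> P\<rbrakk> \<Longrightarrow> norm (f t x c) \<le> K1 * (1 + norm x)"
    using f unfolding regular_rhs_def by blast
  obtain L2 K2 where g_cont: "continuous_on ({0..T} \<times> UNIV \<times> Q) (\<lambda>(t, x, c). g t x c)"
    and g_lip: "\<And>t c. \<lbrakk>t \<in> {0..T}; c \<in> Q\<rbrakk> \<Longrightarrow> L2-lipschitz_on UNIV (\<lambda>x. g t x c)"
    and g_growth: "\<And>t x c. \<lbrakk>t \<in> {0..T}; c \<in> Q\<rbrakk> \<Longrightarrow> norm (g t x c) \<le> K2 * (1 + norm x)"
    using g unfolding regular_rhs_def by blast
  \<comment> \<open>Absolute values, since a growth condition over an empty control set allows a negative constant.\<close>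
  have "control_system T (L1 + L2) (\<bar>K1\<bar> + \<bar>K2\<bar>) (P' \<times> Q') (\<lambda>t x c. f t x (fst c) + g t x (snd c))"
  proof
    show "compact (P' \<times> Q')" using P' Q' by (intro compact_Times)
    let ?D = "{0..T} \<times> (UNIV :: (real^'n) set) \<times> (P' \<times> Q')"
    have "continuous_on ?D (\<lambda>z. (\<lambda>(t, x, c). f t x c) (fst z, fst (snd z), fst (snd (snd z))))"
      using P' by (intro continuous_on_compose2[OF f_cont]) (auto intro!: continuous_intros)
    moreover have "continuous_on ?D (\<lambda>z. (\<lambda>(t, x, c). g t x c) (fst z, fst (snd z), snd (snd (snd z))))"
      using Q' by (intro continuous_on_compose2[OF g_cont]) (auto intro!: continuous_intros)
    ultimately show "continuous_on ?D (\<lambda>(t, x, c). f t x (fst c) + g t x (snd c))"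
      by (simp add: case_prod_unfold continuous_on_add)
    fix t and x :: "real^'n" and c :: "'p \<times> 'q" assume t: "t \<in> {0..T}" and c: "c \<in> P' \<times> Q'"
    show "(L1 + L2)-lipschitz_on UNIV (\<lambda>x. f t x (fst c) + g t x (snd c))"
      using t c P' Q' by (intro lipschitz_on_add f_lip g_lip) auto
    have "norm (f t x (fst c) + g t x (snd c)) \<le> K1 * (1 + norm x) + K2 * (1 + norm x)"
      using t c P' Q' by (intro norm_triangle_mono f_growth g_growth) auto
    also have "\<dots> \<le> \<bar>K1\<bar> * (1 + norm x) + \<bar>K2\<bar> * (1 + norm x)"
      by (intro add_mono mult_right_mono) auto
    finally show "norm (f t x (fst c) + g t x (snd c)) \<le> (\<bar>K1\<bar> + \<bar>K2\<bar>) * (1 + norm x)"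
      by (simp add: algebra_simps)
  qed auto
  then show ?thesis by (rule that)
qed

lemma (in control_system) motion_on_lipschitz:
  assumes x: "motion_on h 0 T w x" and w: "range w \<subseteq> C" and s: "s \<in> {0..T}"
  obtains M where "M-lipschitz_on {0..T} x"
  using motion_lipschitz[OF order_refl order_refl x w motion_bound[OF order_refl order_refl x w s]]
  by fastforce

lemma motion_on_imp_ivp_solution:
  assumes "motion_on (\<lambda>t x c. f t x (fst c) + g t x (snd c)) 0 T w x" "M-lipschitz_on {0..T} x"
  shows "ivp_solution T f g s (x s) (fst \<circ> w) (snd \<circ> w) x"
proof -
  obtain S where "finite S" and S: "\<And>t. t \<in> {0<..<T} - S \<Longrightarrow>
      (x has_vector_derivative f t (x t) (fst (w t)) + g t (x t) (snd (w t))) (at t)"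
    using assms(1) unfolding motion_on_def by metis
  have "AE t in lebesgue_on {0..T}. (x has_vector_derivative
      f t (x t) ((fst \<circ> w) t) + g t (x t) ((snd \<circ> w) t)) (at t within {0..T})"
  proof (rule AE_I')
    have "negligible ((S \<union> {0, T}) \<inter> {0..T})"
      using \<open>finite S\<close> by (intro negligible_finite) auto
    then show "(S \<union> {0, T}) \<inter> {0..T} \<in> null_sets (lebesgue_on {0..T})"
      by (simp add: null_sets_restrict_space negligible_iff_null_sets)
    show "{t \<in> space (lebesgue_on {0..T}). \<not> (x has_vector_derivative
        f t (x t) ((fst \<circ> w) t) + g t (x t) ((snd \<circ> w) t)) (at t within {0..T})}
        \<subseteq> (S \<union> {0, T}) \<inter> {0..T}"
      using S by (fastforce simp: intro: has_vector_derivative_at_within)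
  qed
  then show ?thesis
    using lipschitz_imp_abs_continuous_on_ivl[OF assms(2)] by (simp add: ivp_solution_def)
qed

lemma borel_measurable_imp_control:
  assumes "u \<in> borel_measurable borel" "range u \<subseteq> P"
  shows "u \<in> controls T P"
proof -
  have "u \<in> borel_measurable (lebesgue_on {0..T})"
    using assms(1) by (intro measurable_restrict_space1 measurable_completion) simp
  then show ?thesis using assms(2) by (auto simp: controls_def)
qed

text \<open>The hypotheses on \<open>U\<close> and \<open>V\<close> ask only for controls with values in \<open>P'\<close> or \<open>Q'\<close> on the whole line,
  not just on \<open>{0..T}\<close>.  For \<open>P' = {u}\<close> this leaves the constant function alone, so that \<open>U\<close> may be
  the singleton used for a constant control.\<close>

lemma feedback_limit_in_closure:
  fixes f :: "real \<Rightarrow> real^'n \<Rightarrow> 'p::metric_space \<Rightarrow> real^'n"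
    and g :: "real \<Rightarrow> real^'n \<Rightarrow> 'q::metric_space \<Rightarrow> real^'n"
  defines "h \<equiv> (\<lambda>t x c. f t x (fst c) + g t x (snd c))"
  assumes fg: "regular_rhs T P f" "regular_rhs T Q g"
    and P': "compact P'" "P' \<subseteq> P" and Q': "compact Q'" "Q' \<subseteq> Q"
    and UV: "controls T P' \<inter> {u. range u \<subseteq> P'} \<subseteq> U" "controls T Q' \<inter> {v. range v \<subseteq> Q'} \<subseteq> V"
    and "finite \<Phi>" and \<Phi>: "\<And>\<phi>. \<phi> \<in> \<Phi> \<Longrightarrow> dissipative T h k \<phi>"
    and k: "\<And>t x. t \<in> {0..T} \<Longrightarrow> k t x \<in> P' \<times> Q'"
    and s: "s \<in> {0..T}"
  obtains y where "y \<in> cl_C T (motions T f g s \<xi> U V)"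
    "\<And>\<phi> t. \<lbrakk>\<phi> \<in> \<Phi>; t \<in> {s..T}\<rbrakk> \<Longrightarrow> \<phi> t (y t) \<le> \<phi> s \<xi>"
proof -
  obtain L K where "control_system T L K (P' \<times> Q') h"
    using control_system_of_regular_rhs[OF fg P' Q'] unfolding h_def by blast
  then interpret control_system T L K "P' \<times> Q'" h .
  obtain y where y: "continuous_on {0..T} y"
    "\<And>\<epsilon>. 0 < \<epsilon> \<Longrightarrow> \<exists>w x. motion_on h 0 T w x \<and> x s = \<xi> \<and> range w \<subseteq> P' \<times> Q' \<and>
       w \<in> borel_measurable borel \<and> (\<forall>t\<in>{0..T}. dist (y t) (x t) < \<epsilon>)"
    "\<And>\<phi> t. \<lbrakk>\<phi> \<in> \<Phi>; t \<in> {s..T}\<rbrakk> \<Longrightarrow> \<phi> t (y t) \<le> \<phi> s \<xi>"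
    using dissipative_limit_motion[OF \<open>finite \<Phi>\<close> \<Phi> k s, of \<xi>] by blast
  show thesis
  proof
    show "restrict y {0..T} \<in> cl_C T (motions T f g s \<xi> U V)"
    proof (rule cl_C_memI[OF y(1)])
      fix \<epsilon> :: real assume "0 < \<epsilon>"
      then obtain w x where x: "motion_on h 0 T w x" "x s = \<xi>" and w: "range w \<subseteq> P' \<times> Q'"
        "w \<in> borel_measurable borel" and close: "\<forall>t\<in>{0..T}. dist (y t) (x t) < \<epsilon>"
        using y(2) by blast
      obtain M where "M-lipschitz_on {0..T} x"
        using motion_on_lipschitz[OF x(1) w(1) s] .
      then have sol: "ivp_solution T f g s \<xi> (fst \<circ> w) (snd \<circ> w) x"
        using motion_on_imp_ivp_solution[of f g T w x M s] x by (simp add: h_def)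
      have "fst \<circ> w \<in> borel_measurable borel" "snd \<circ> w \<in> borel_measurable borel"
        by (rule measurable_comp[OF w(2)]; intro borel_measurable_continuous_onI continuous_intros)+
      moreover have "range (fst \<circ> w) \<subseteq> P'" "range (snd \<circ> w) \<subseteq> Q'"
        using w(1) by (auto simp: image_subset_iff mem_Times_iff)
      ultimately have "fst \<circ> w \<in> U" "snd \<circ> w \<in> V"
        using borel_measurable_imp_control[of "fst \<circ> w" P' T]
          borel_measurable_imp_control[of "snd \<circ> w" Q' T] UV by blast+
      with sol have "restrict x {0..T} \<in> motions T f g s \<xi> U V"
        unfolding motions_def by blast
      then show "\<exists>x. continuous_on {0..T} x \<and> restrict x {0..T} \<in> motions T f g s \<xi> U V \<and>
          (\<forall>t\<in>{0..T}. dist (y t) (x t) < \<epsilon>)"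
        using close x(1) by (auto simp: motion_on_def)
    qed
    fix \<phi> t assume "\<phi> \<in> \<Phi>" "t \<in> {s..T}"
    then show "\<phi> t (restrict y {0..T} t) \<le> \<phi> s \<xi>"
      using y(3) s by simp
  qed
qed

section \<open>Derivatives of the value functions\<close>

lemma grad_inner:
  assumes "(h has_derivative h') (at x)"
  shows "grad h x \<bullet> y = h' y"
proof -
  have lin: "linear h'"
    using assms by (rule has_derivative_linear)
  define s where "s = adjoint h' 1"
  have s: "h' y = y \<bullet> s" for y
    using adjoint_works[OF lin, of y 1] by (simp add: s_def)
  have "h' = (\<lambda>d. d \<bullet> s)" using s by (rule ext)
  then have "GDERIV h x :> s"
    using assms by (simp add: gderiv_def)
  moreover have "s' = s" if "GDERIV h x :> s'" for s'
  proof -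
    have "(\<lambda>d. d \<bullet> s') = h'"
      using that assms unfolding gderiv_def by (rule has_derivative_unique)
    then have "\<forall>d. d \<bullet> s' = d \<bullet> s" using s by metis
    then show ?thesis by (simp add: vector_eq_ldot)
  qed
  ultimately have "grad h x = s"
    unfolding grad_def by (rule the_equality)
  then show ?thesis by (simp add: s inner_commute)
qed

text \<open>The derivative on the strip, one-sided in time at the ends, splits into the partial derivatives
  that occur in the Hamilton--Jacobi equations.  \<open>T > 0\<close> makes the one-sided derivative unique.\<close>

lemma C1_strip_directional_derivative:
  fixes \<phi> :: "real \<Rightarrow> real^'n \<Rightarrow> real" and D :: "(real \<times> (real^'n)) \<Rightarrow>\<^sub>L real"
  assumes "0 < T" and t: "t \<in> {0..T}"
    and der: "((\<lambda>(t, x). \<phi> t x) has_derivative blinfun_apply D) (at (t, x) within {0..T} \<times> UNIV)"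
  shows "D (1, y) = time_deriv T \<phi> t x + grad (\<phi> t) x \<bullet> y"
proof -
  have "((\<lambda>\<tau>. (\<lambda>(t, x). \<phi> t x) (\<tau>, x)) has_derivative (\<lambda>d. D (d, 0))) (at t within {0..T})"
  proof (rule has_derivative_in_compose[where f = "\<lambda>\<tau>. (\<tau>, x)" and g = "\<lambda>(t, x). \<phi> t x"])
    show "((\<lambda>\<tau>. (\<tau>, x)) has_derivative (\<lambda>d. (d, 0))) (at t within {0..T})"
      by (auto intro!: derivative_eq_intros)
    show "((\<lambda>(t, x). \<phi> t x) has_derivative blinfun_apply D) (at (t, x) within (\<lambda>\<tau>. (\<tau>, x)) ` {0..T})"
      using der by (rule has_derivative_subset) auto
  qed
  moreover have "(\<lambda>d. D (d, 0)) = (\<lambda>d. d *\<^sub>R D (1, 0))"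
  proof
    show "D (d, 0) = d *\<^sub>R D (1, 0)" for d
      using blinfun.scaleR_right[of D d "(1, 0)"] by simp
  qed
  ultimately have "((\<lambda>\<tau>. \<phi> \<tau> x) has_vector_derivative D (1, 0)) (at t within {0..T})"
    by (simp only: has_vector_derivative_def prod.case)
  then have time: "time_deriv T \<phi> t x = D (1, 0)"
    unfolding time_deriv_def using vector_derivative_within_cbox[of 0 T t] assms by auto
  have "((\<lambda>y. (\<lambda>(t, x). \<phi> t x) (t, y)) has_derivative (\<lambda>d. D (0, d))) (at x)"
  proof (rule has_derivative_in_compose[where f = "\<lambda>y. (t, y)" and g = "\<lambda>(t, x). \<phi> t x"])
    show "((\<lambda>y. (t, y)) has_derivative (\<lambda>d. (0, d))) (at x)"
      by (auto intro!: derivative_eq_intros)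
    show "((\<lambda>(t, x). \<phi> t x) has_derivative blinfun_apply D) (at (t, x) within range (\<lambda>y. (t, y)))"
      using der by (rule has_derivative_subset) (use t in auto)
  qed
  then have "grad (\<phi> t) x \<bullet> y = D (0, y)"
    by (intro grad_inner) simp
  then show ?thesis
    using time blinfun.add_right[of D "(1, 0)" "(0, y)"] by simp
qed

text \<open>The factor \<open>\<sigma>\<close> is there to treat \<open>\<phi>\<close> and \<open>- \<phi>\<close> together.\<close>

lemma dissipative_of_C1_strip:
  fixes \<phi> :: "real \<Rightarrow> real^'n \<Rightarrow> real"
  assumes "0 < T" and "C1_strip T \<phi>"
    and le: "\<And>t x. t \<in> {0..T} \<Longrightarrow>
      \<sigma> * (time_deriv T \<phi> t x + grad (\<phi> t) x \<bullet> h t x (k t x)) \<le> 0"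
  shows "dissipative T h k (\<lambda>t x. \<sigma> * \<phi> t x)"
proof -
  obtain \<phi>' :: "real \<times> (real^'n) \<Rightarrow> (real \<times> (real^'n)) \<Rightarrow>\<^sub>L real" where
    \<phi>'_cont: "continuous_on ({0..T} \<times> UNIV) \<phi>'" and
    \<phi>'_deriv: "\<And>z. z \<in> {0..T} \<times> UNIV \<Longrightarrow>
      ((\<lambda>(t, x). \<phi> t x) has_derivative blinfun_apply (\<phi>' z)) (at z within {0..T} \<times> UNIV)"
    using assms(2) unfolding C1_strip_def by metis
  show ?thesis
    unfolding dissipative_def
  proof (intro exI[of _ "\<lambda>z. \<sigma> *\<^sub>R \<phi>' z"] conjI ballI allI)
    show "continuous_on ({0..T} \<times> UNIV) (\<lambda>z. \<sigma> *\<^sub>R \<phi>' z)"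
      by (intro continuous_intros \<phi>'_cont)
    show "((\<lambda>(t, x). \<sigma> * \<phi> t x) has_derivative blinfun_apply (\<sigma> *\<^sub>R \<phi>' z))
        (at z within {0..T} \<times> UNIV)" if "z \<in> {0..T} \<times> UNIV" for z
      using has_derivative_mult_right[OF \<phi>'_deriv[OF that], of \<sigma>]
      by (simp add: case_prod_unfold scaleR_blinfun.rep_eq)
    fix t x assume t: "t \<in> {0..T}"
    then show "blinfun_apply (\<sigma> *\<^sub>R \<phi>' (t, x)) (1, h t x (k t x)) \<le> 0"
      using le[OF t, of x] C1_strip_directional_derivative[OF \<open>0 < T\<close> t \<phi>'_deriv[of "(t, x)"]]
      by (simp add: scaleR_blinfun.rep_eq)
  qed
qed

section \<open>Classical solutions satisfy the equilibrium conditions\<close>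

theorem proposition3p3:
  fixes T :: real
    and P :: "'p::metric_space set" and Q :: "'q::metric_space set"
    and f :: "real \<Rightarrow> real^'n \<Rightarrow> 'p \<Rightarrow> real^'n"
    and g :: "real \<Rightarrow> real^'n \<Rightarrow> 'q \<Rightarrow> real^'n"
    and \<sigma>1 \<sigma>2 :: "real^'n \<Rightarrow> real"
    and uh :: "real \<Rightarrow> real^'n \<Rightarrow> real^'n \<Rightarrow> 'p"
    and vh :: "real \<Rightarrow> real^'n \<Rightarrow> real^'n \<Rightarrow> 'q"
    and \<phi>1 \<phi>2 :: "real \<Rightarrow> real^'n \<Rightarrow> real"
  assumes "0 < T"
    and "compact P" "P \<noteq> {}" and "compact Q" "Q \<noteq> {}"
    and "regular_rhs T P f" and "regular_rhs T Q g"
    and "continuous_on UNIV \<sigma>1" and "continuous_on UNIV \<sigma>2"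
    and "max_selection T P f uh" and "max_selection T Q g vh"
    and "classical_solution T f g uh vh \<sigma>1 \<sigma>2 \<phi>1 \<phi>2"
  shows
    "(\<forall>x. \<phi>1 T x = \<sigma>1 x \<and> \<phi>2 T x = \<sigma>2 x) \<and>
     (\<forall>ts\<in>{0..T}. \<forall>xs. \<forall>u\<in>P. \<exists>y2\<in>Sol2 T f g Q ts xs u.
        \<forall>t\<in>{ts..T}. \<phi>1 t (y2 t) \<le> \<phi>1 ts xs) \<and>
     (\<forall>ts\<in>{0..T}. \<forall>xs. \<forall>v\<in>Q. \<exists>y1\<in>Sol1 T f g P ts xs v.
        \<forall>t\<in>{ts..T}. \<phi>2 t (y1 t) \<le> \<phi>2 ts xs) \<and>
     (\<forall>ts\<in>{0..T}. \<forall>xs. \<exists>yc\<in>Sol T f g P Q ts xs.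
        \<forall>t\<in>{ts..T}. \<phi>1 t (yc t) = \<phi>1 ts xs \<and> \<phi>2 t (yc t) = \<phi>2 ts xs)"
proof -
  have fg: "regular_rhs T P f" "regular_rhs T Q g" by fact+
  have uh: "uh t x s \<in> P" "w \<in> P \<Longrightarrow> s \<bullet> f t x w \<le> s \<bullet> f t x (uh t x s)" if "t \<in> {0..T}" for t x s w
    using \<open>max_selection T P f uh\<close> that unfolding max_selection_def is_arg_max_linorder by auto
  have vh: "vh t x s \<in> Q" "w \<in> Q \<Longrightarrow> s \<bullet> g t x w \<le> s \<bullet> g t x (vh t x s)" if "t \<in> {0..T}" for t x s w
    using \<open>max_selection T Q g vh\<close> that unfolding max_selection_def is_arg_max_linorder by auto
  have C1: "C1_strip T \<phi>1" "C1_strip T \<phi>2"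
    and HJ1: "\<And>t x. t \<in> {0..T} \<Longrightarrow>
      time_deriv T \<phi>1 t x + Ham1 f g uh vh t x (grad (\<phi>1 t) x) (grad (\<phi>2 t) x) = 0"
    and HJ2: "\<And>t x. t \<in> {0..T} \<Longrightarrow>
      time_deriv T \<phi>2 t x + Ham2 f g uh vh t x (grad (\<phi>1 t) x) (grad (\<phi>2 t) x) = 0"
    and terminal: "\<forall>x. \<phi>1 T x = \<sigma>1 x \<and> \<phi>2 T x = \<sigma>2 x"
    using \<open>classical_solution T f g uh vh \<sigma>1 \<sigma>2 \<phi>1 \<phi>2\<close> unfolding classical_solution_def by auto
  let ?h = "\<lambda>t x c. f t x (fst c) + g t x (snd c)"
  let ?u = "\<lambda>t x. uh t x (grad (\<phi>1 t) x)" and ?v = "\<lambda>t x. vh t x (grad (\<phi>2 t) x)"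
  have "\<exists>y2\<in>Sol2 T f g Q ts xs u. \<forall>t\<in>{ts..T}. \<phi>1 t (y2 t) \<le> \<phi>1 ts xs"
    if ts: "ts \<in> {0..T}" and "u \<in> P" for ts xs u
  proof -
    have "dissipative T ?h (\<lambda>t x. (u, ?v t x)) (\<lambda>t x. 1 * \<phi>1 t x)"
    proof (rule dissipative_of_C1_strip[OF \<open>0 < T\<close> C1(1)])
      fix t x assume t: "t \<in> {0..T}"
      then show "1 * (time_deriv T \<phi>1 t x + grad (\<phi>1 t) x \<bullet> ?h t x (u, ?v t x)) \<le> 0"
        using HJ1[OF t, of x] uh(2)[OF t \<open>u \<in> P\<close>, of "grad (\<phi>1 t) x" x]
        by (simp add: Ham1_def inner_add_right)
    qed
    then have diss: "dissipative T ?h (\<lambda>t x. (u, ?v t x)) \<phi>" if "\<phi> \<in> {\<phi>1}" for \<phi>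
      using that by simp
    have U: "controls T {u} \<inter> {u'. range u' \<subseteq> {u}} \<subseteq> {\<lambda>_. u}" by auto
    have sub: "compact {u}" "{u} \<subseteq> P" and fin: "finite {\<phi>1}" using \<open>u \<in> P\<close> by auto
    have fb: "(u, ?v t x) \<in> {u} \<times> Q" if "t \<in> {0..T}" for t x
      using vh(1)[OF that] by simp
    obtain y where "y \<in> cl_C T (motions T f g ts xs {\<lambda>_. u} (controls T Q))"
      "\<And>\<phi> t. \<lbrakk>\<phi> \<in> {\<phi>1}; t \<in> {ts..T}\<rbrakk> \<Longrightarrow> \<phi> t (y t) \<le> \<phi> ts xs"
      using feedback_limit_in_closure[OF fg sub \<open>compact Q\<close> order_refl U Int_lower1 fin diss fb ts]
      by blast
    then show ?thesis unfolding Sol2_def by blast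
  qed
  moreover have "\<exists>y1\<in>Sol1 T f g P ts xs v. \<forall>t\<in>{ts..T}. \<phi>2 t (y1 t) \<le> \<phi>2 ts xs"
    if ts: "ts \<in> {0..T}" and "v \<in> Q" for ts xs v
  proof -
    have "dissipative T ?h (\<lambda>t x. (?u t x, v)) (\<lambda>t x. 1 * \<phi>2 t x)"
    proof (rule dissipative_of_C1_strip[OF \<open>0 < T\<close> C1(2)])
      fix t x assume t: "t \<in> {0..T}"
      then show "1 * (time_deriv T \<phi>2 t x + grad (\<phi>2 t) x \<bullet> ?h t x (?u t x, v)) \<le> 0"
        using HJ2[OF t, of x] vh(2)[OF t \<open>v \<in> Q\<close>, of "grad (\<phi>2 t) x" x]
        by (simp add: Ham2_def inner_add_right)
    qed
    then have diss: "dissipative T ?h (\<lambda>t x. (?u t x, v)) \<phi>" if "\<phi> \<in> {\<phi>2}" for \<phi>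
      using that by simp
    have V: "controls T {v} \<inter> {v'. range v' \<subseteq> {v}} \<subseteq> {\<lambda>_. v}" by auto
    have sub: "compact {v}" "{v} \<subseteq> Q" and fin: "finite {\<phi>2}" using \<open>v \<in> Q\<close> by auto
    have fb: "(?u t x, v) \<in> P \<times> {v}" if "t \<in> {0..T}" for t x
      using uh(1)[OF that] by simp
    obtain y where "y \<in> cl_C T (motions T f g ts xs (controls T P) {\<lambda>_. v})"
      "\<And>\<phi> t. \<lbrakk>\<phi> \<in> {\<phi>2}; t \<in> {ts..T}\<rbrakk> \<Longrightarrow> \<phi> t (y t) \<le> \<phi> ts xs"
      using feedback_limit_in_closure[OF fg \<open>compact P\<close> order_refl sub Int_lower1 V fin diss fb ts]
      by blast
    then show ?thesis unfolding Sol1_def by blast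
  qed
  moreover have "\<exists>yc\<in>Sol T f g P Q ts xs. \<forall>t\<in>{ts..T}. \<phi>1 t (yc t) = \<phi>1 ts xs \<and> \<phi>2 t (yc t) = \<phi>2 ts xs"
    if ts: "ts \<in> {0..T}" for ts xs
  proof -
    let ?\<Phi> = "{\<lambda>t x. \<sigma> * \<phi> t x | \<sigma> \<phi>. \<sigma> \<in> {1, -1} \<and> \<phi> \<in> {\<phi>1, \<phi>2}}"
    have diss: "dissipative T ?h (\<lambda>t x. (?u t x, ?v t x)) \<phi>" if "\<phi> \<in> ?\<Phi>" for \<phi>
    proof -
      have "dissipative T ?h (\<lambda>t x. (?u t x, ?v t x)) (\<lambda>t x. \<sigma> * \<phi>1 t x)"
        "dissipative T ?h (\<lambda>t x. (?u t x, ?v t x)) (\<lambda>t x. \<sigma> * \<phi>2 t x)" for \<sigma>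
        using HJ1 HJ2 by (auto intro!: dissipative_of_C1_strip \<open>0 < T\<close> C1 simp: Ham1_def Ham2_def)
      then show ?thesis using that by auto
    qed
    have fin: "finite ?\<Phi>" by (intro finite_image_set2) auto
    have fb: "(?u t x, ?v t x) \<in> P \<times> Q" if "t \<in> {0..T}" for t x
      using uh(1)[OF that] vh(1)[OF that] by simp
    obtain y where y: "y \<in> cl_C T (motions T f g ts xs (controls T P) (controls T Q))"
      "\<And>\<phi> t. \<lbrakk>\<phi> \<in> ?\<Phi>; t \<in> {ts..T}\<rbrakk> \<Longrightarrow> \<phi> t (y t) \<le> \<phi> ts xs"
      using feedback_limit_in_closure[OF fg \<open>compact P\<close> order_refl \<open>compact Q\<close> order_refl
          Int_lower1 Int_lower1 fin diss fb ts] by blast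
    have "\<phi> t (y t) = \<phi> ts xs" if "\<phi> \<in> {\<phi>1, \<phi>2}" "t \<in> {ts..T}" for \<phi> t
    proof -
      have "\<sigma> * \<phi> t (y t) \<le> \<sigma> * \<phi> ts xs" if "\<sigma> \<in> {1, -1}" for \<sigma>
        using y(2)[of "\<lambda>t x. \<sigma> * \<phi> t x" t] that \<open>\<phi> \<in> {\<phi>1, \<phi>2}\<close> \<open>t \<in> {ts..T}\<close> by blast
      from this[of 1] this[of "-1"] show ?thesis by simp
    qed
    then show ?thesis using y(1) unfolding Sol_def by blast
  qed
  ultimately show ?thesis using terminal by blast
qed

end
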